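(* Let $\mathcal{M}$ be a von Neumann algebra and let $\preceq$ be the star order on $\mathcal{M}$. Then (i) $\tau_o(\mathcal{M},\preceq)|_{\mathcal{M}_{pi}}=\tau_o(\mathcal{M}_{pi},\preceq)$; (ii) $\tau_o(\mathcal{M},\preceq)|_{\mathcal{M}_{sa}}=\tau_o(\mathcal{M}_{sa},\preceq)$; (iii) $\tau_o(\mathcal{M},\preceq)|_{\mathcal{M}_+}=\tau_o(\mathcal{M}_{sa},\preceq)|_{\mathcal{M}_+}=\tau_o(\mathcal{M}_+,\preceq)$; (iv) $\tau_o(\mathcal{M},\preceq)|_{P(\mathcal{M})}=\tau_o(\mathcal{M}_{sa},\preceq)|_{P(\mathcal{M})}=\tau_o(\mathcal{M}_+,\preceq)|_{P(\mathcal{M})}=\tau_o(P(\mathcal{M}),\preceq)$.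
   Context: A von Neumann algebra is a strongly closed C*-subalgebra of the C*-algebra $\mathscr{B}(\mathscr{H})$ of all bounded operators on a complex Hilbert space $\mathscr{H}$. The star order on $\mathcal{M}$ is the partial order defined by $x\preceq y$ if and only if $x^*x=x^*y$ and $xx^*=yx^*$; subsets of $\mathcal{M}$ carry the restricted order. $P(\mathcal{M})$, $\mathcal{M}_{sa}$, $\mathcal{M}_+$ and $\mathcal{M}_{pi}$ denote the sets of all projections, self-adjoint elements, positive elements (in the usual operator sense) and partial isometries of $\mathcal{M}$, respectively. For a topology $\tau$ on a set $X$ and $Y\subseteq X$, $\tau|_Y$ denotes the relative (subspace) topology on $Y$. Order convergence and order topology: let $(P,\leq)$ be a poset. A net $(x_\alpha)_{\alpha\in\Gamma}$ in $P$ is order convergent to $x\in P$ in $(P,\leq)$ if there are nets $(y_\alpha)_{\alpha\in\Gamma}$ and $(z_\alpha)_{\alpha\in\Gamma}$ in $P$ (with the same index set) such that $y_\alpha\leq x_\alpha\leq z_\alpha$ for all $\alpha\in\Gamma$, $(y_\alpha)$ is increasing with supremum $x$ in $P$, and $(z_\alpha)$ is decreasing with infimum $x$ in $P$ (supremum and infimum taken in the poset $P$ itself). A subset $C\subseteq P$ is order closed if no net in $C$ is order convergent to a point of $P\setminus C$. The order topology $\tau_o(P,\leq)$ is the topology on $P$ whose closed sets are exactly the order closed sets. *)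

theory Defs
  imports "HOL-Analysis.Analysis"
begin

section \<open>Complex Hilbert spaces\<close>

text \<open>
  The norm of a complex Hilbert space is the one inherited from \<^class>\<open>real_inner\<close>; by
  \<open>inner_eq_Re_cinner\<close> and \<open>cinner_commute\<close> it satisfies \<open>(norm x)\<^sup>2 = cinner x x\<close>.
  The complex inner product is linear in the first argument.
\<close>

class complex_inner = real_inner +
  fixes scaleC :: "complex \<Rightarrow> 'a \<Rightarrow> 'a"  (infixr "*\<^sub>C" 75)
    and cinner :: "'a \<Rightarrow> 'a \<Rightarrow> complex"
  assumes scaleC_add_right: "c *\<^sub>C (x + y) = c *\<^sub>C x + c *\<^sub>C y"
    and scaleC_add_left: "(c + d) *\<^sub>C x = c *\<^sub>C x + d *\<^sub>C x"
    and scaleC_scaleC: "c *\<^sub>C d *\<^sub>C x = (c * d) *\<^sub>C x"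
    and scaleR_eq_scaleC: "r *\<^sub>R x = complex_of_real r *\<^sub>C x"
    and cinner_add_left: "cinner (x + y) z = cinner x z + cinner y z"
    and cinner_scaleC_left: "cinner (c *\<^sub>C x) y = c * cinner x y"
    and cinner_commute: "cinner x y = cnj (cinner y x)"
    and inner_eq_Re_cinner: "inner x y = Re (cinner x y)"

class chilbert_space = complex_inner + complete_space

lemma cinner_self: "cinner x x = complex_of_real ((norm x)\<^sup>2)" for x :: "'h::complex_inner"
proof -
  have "Im (cinner x x) = 0"
    using arg_cong[OF cinner_commute[of x x], of Im] by simp
  moreover have "Re (cinner x x) = (norm x)\<^sup>2"
    by (simp add: power2_norm_eq_inner inner_eq_Re_cinner)
  ultimately show ?thesis by (simp add: complex_eq_iff)
qed

lemma norm_scaleC: "norm (c *\<^sub>C x) = cmod c * norm x" for x :: "'h::complex_inner"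
proof -
  have "cinner (c *\<^sub>C x) (c *\<^sub>C x) = c * cnj (c * cinner x x)"
    by (metis cinner_commute cinner_scaleC_left)
  also have "\<dots> = complex_of_real ((cmod c * norm x)\<^sup>2)"
    by (simp add: cinner_self power_mult_distrib mult.assoc[symmetric] complex_norm_square[symmetric])
  finally have "(norm (c *\<^sub>C x))\<^sup>2 = (cmod c * norm x)\<^sup>2"
    unfolding cinner_self of_real_eq_iff .
  then show ?thesis by simp
qed

section \<open>Operators and von Neumann algebras\<close>

text \<open>
  The type \<open>'h \<Rightarrow>\<^sub>L 'h\<close> consists of the bounded real-linear operators, so the
  complex-linear ones have to be singled out. The operator norm is the same in both settings.
\<close>

definition cbounded_ops :: "('h::chilbert_space \<Rightarrow>\<^sub>L 'h) set" where
  "cbounded_ops = {x :: 'h \<Rightarrow>\<^sub>L 'h. \<forall>c h. x (c *\<^sub>C h) = c *\<^sub>C x h}"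

definition scaleC_op :: "complex \<Rightarrow> ('h::chilbert_space \<Rightarrow>\<^sub>L 'h) \<Rightarrow> 'h \<Rightarrow>\<^sub>L 'h" where
  "scaleC_op c x = Blinfun (\<lambda>h. c *\<^sub>C x h)"

lemma scaleC_op_apply: "blinfun_apply (scaleC_op c x) h = c *\<^sub>C blinfun_apply x h"
proof -
  have "bounded_linear (\<lambda>h. c *\<^sub>C x h)"
  proof (rule bounded_linear_intro[where K = "cmod c * norm x"])
    fix r h
    show "c *\<^sub>C x (r *\<^sub>R h) = r *\<^sub>R c *\<^sub>C x h"
      unfolding blinfun.scaleR_right by (simp add: scaleR_eq_scaleC scaleC_scaleC mult.commute)
    show "norm (c *\<^sub>C x h) \<le> norm h * (cmod c * norm x)"
      using mult_left_mono[OF norm_blinfun[of x h], of "cmod c"]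
      by (simp add: norm_scaleC mult_ac)
  qed (simp add: blinfun.add_right scaleC_add_right)
  then show ?thesis by (simp add: scaleC_op_def bounded_linear_Blinfun_apply)
qed

text \<open>Every element of \<^const>\<open>cbounded_ops\<close> has an adjoint; elsewhere the value is irrelevant.\<close>

definition adj :: "('h::chilbert_space \<Rightarrow>\<^sub>L 'h) \<Rightarrow> 'h \<Rightarrow>\<^sub>L 'h" where
  "adj x = (THE y :: 'h \<Rightarrow>\<^sub>L 'h. \<forall>h k. cinner (x h) k = cinner h (y k))"

lemma adj_eqI:
  assumes "\<And>h k. cinner (blinfun_apply x h) k = cinner h (blinfun_apply y k)"
  shows "adj x = y"
  unfolding adj_def
proof (rule the_equality)
  fix z assume z: "\<forall>h k. cinner (blinfun_apply x h) k = cinner h (blinfun_apply z k)"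
  show "z = y"
  proof (rule blinfun_eqI)
    fix k
    have "inner h (z k) = inner h (y k)" for h
      using assms z by (simp add: inner_eq_Re_cinner)
    then show "z k = y k" by (metis vector_eq_rdot inner_commute)
  qed
qed (use assms in simp)

definition cstar_subalgebra :: "('h::chilbert_space \<Rightarrow>\<^sub>L 'h) set \<Rightarrow> bool" where
  "cstar_subalgebra M \<longleftrightarrow>
     M \<subseteq> cbounded_ops \<and> 0 \<in> M \<and>
     (\<forall>x\<in>M. \<forall>y\<in>M. x + y \<in> M) \<and>
     (\<forall>c. \<forall>x\<in>M. scaleC_op c x \<in> M) \<and>
     (\<forall>x\<in>M. \<forall>y\<in>M. x o\<^sub>L y \<in> M) \<and>
     (\<forall>x\<in>M. adj x \<in> M) \<and>
     closed M"

text \<open>The unit of a von Neumann algebra need not be the identity operator.\<close>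

definition von_neumann_algebra :: "('h::chilbert_space \<Rightarrow>\<^sub>L 'h) set \<Rightarrow> bool" where
  "von_neumann_algebra M \<longleftrightarrow>
     cstar_subalgebra M \<and> closedin (subtopology strong_operator_topology cbounded_ops) M"

definition projections :: "('h::chilbert_space \<Rightarrow>\<^sub>L 'h) set \<Rightarrow> ('h \<Rightarrow>\<^sub>L 'h) set" where
  "projections M = {p \<in> M. adj p = p \<and> p o\<^sub>L p = p}"

definition self_adjoints :: "('h::chilbert_space \<Rightarrow>\<^sub>L 'h) set \<Rightarrow> ('h \<Rightarrow>\<^sub>L 'h) set" where
  "self_adjoints M = {x \<in> M. adj x = x}"

definition positives :: "('h::chilbert_space \<Rightarrow>\<^sub>L 'h) set \<Rightarrow> ('h \<Rightarrow>\<^sub>L 'h) set" where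
  "positives M = {x \<in> M. \<forall>h. cinner (x h) h \<in> \<real>\<^sub>\<ge>\<^sub>0}"

definition partial_isometries :: "('h::chilbert_space \<Rightarrow>\<^sub>L 'h) set \<Rightarrow> ('h \<Rightarrow>\<^sub>L 'h) set" where
  "partial_isometries M = {v \<in> M. adj v o\<^sub>L v \<in> projections M}"

definition star_le :: "('h::chilbert_space \<Rightarrow>\<^sub>L 'h) \<Rightarrow> ('h \<Rightarrow>\<^sub>L 'h) \<Rightarrow> bool"  (infix "\<preceq>\<^sub>\<star>" 50) where
  "x \<preceq>\<^sub>\<star> y \<longleftrightarrow> adj x o\<^sub>L x = adj x o\<^sub>L y \<and> x o\<^sub>L adj x = y o\<^sub>L adj x"

section \<open>Order convergence and order topology\<close>

text \<open>A poset is given by a carrier \<open>P\<close> and a relation \<open>le\<close> that only matters on \<open>P\<close>.\<close>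

definition is_sup_in :: "'a set \<Rightarrow> ('a \<Rightarrow> 'a \<Rightarrow> bool) \<Rightarrow> 'a set \<Rightarrow> 'a \<Rightarrow> bool" where
  "is_sup_in P le S s \<longleftrightarrow>
     s \<in> P \<and> (\<forall>x\<in>S. le x s) \<and> (\<forall>u\<in>P. (\<forall>x\<in>S. le x u) \<longrightarrow> le s u)"

definition is_inf_in :: "'a set \<Rightarrow> ('a \<Rightarrow> 'a \<Rightarrow> bool) \<Rightarrow> 'a set \<Rightarrow> 'a \<Rightarrow> bool" where
  "is_inf_in P le = is_sup_in P (\<lambda>a b. le b a)"

definition directed_index :: "'i set \<Rightarrow> ('i \<Rightarrow> 'i \<Rightarrow> bool) \<Rightarrow> bool" where
  "directed_index I leI \<longleftrightarrow>
     I \<noteq> {} \<and> reflp_on I leI \<and> transp_on I leI \<and> (\<forall>a\<in>I. \<forall>b\<in>I. \<exists>c\<in>I. leI a c \<and> leI b c)"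

definition order_convergent ::
    "'a set \<Rightarrow> ('a \<Rightarrow> 'a \<Rightarrow> bool) \<Rightarrow> 'i set \<Rightarrow> ('i \<Rightarrow> 'i \<Rightarrow> bool) \<Rightarrow> ('i \<Rightarrow> 'a) \<Rightarrow> 'a \<Rightarrow> bool" where
  "order_convergent P le I leI x l \<longleftrightarrow>
     (\<exists>y\<in>I \<rightarrow> P. \<exists>z\<in>I \<rightarrow> P.
        (\<forall>i\<in>I. le (y i) (x i) \<and> le (x i) (z i)) \<and>
        monotone_on I leI le y \<and> is_sup_in P le (y ` I) l \<and>
        monotone_on I leI (\<lambda>a b. le b a) z \<and> is_inf_in P le (z ` I) l)"

text \<open>
  HOL cannot quantify over the index type of a net inside a definition, so here the index sets
  are subsets of \<open>'a \<times> 'a\<close>. This is no restriction: the lemma \<open>order_closedD\<close> below shows that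
  an order closed set is closed under order limits of nets over index sets of any type
  (a net can be reindexed by the pairs \<open>(y i, z i)\<close> of its bounds).
\<close>

definition order_closed :: "'a set \<Rightarrow> ('a \<Rightarrow> 'a \<Rightarrow> bool) \<Rightarrow> 'a set \<Rightarrow> bool" where
  "order_closed P le C \<longleftrightarrow>
     C \<subseteq> P \<and>
     \<not> (\<exists>(I :: ('a \<times> 'a) set) leI. directed_index I leI \<and>
          (\<exists>x\<in>I \<rightarrow> C. \<exists>l\<in>P - C. order_convergent P le I leI x l))"

lemma order_closedD:
  fixes I :: "'i set"
  assumes closed: "order_closed P le C"
    and po: "reflp_on P le" "transp_on P le"
    and dir: "directed_index I leI"
    and x: "x \<in> I \<rightarrow> C" and l: "l \<in> P" and conv: "order_convergent P le I leI x l"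
  shows "l \<in> C"
proof (rule ccontr)
  assume "l \<notin> C"
  obtain y z where yz: "y \<in> I \<rightarrow> P" "z \<in> I \<rightarrow> P"
    and le: "\<And>i. i \<in> I \<Longrightarrow> le (y i) (x i) \<and> le (x i) (z i)"
    and y: "monotone_on I leI le y" "is_sup_in P le (y ` I) l"
    and z: "monotone_on I leI (\<lambda>a b. le b a) z" "is_inf_in P le (z ` I) l"
    using conv unfolding order_convergent_def by blast
  define J where "J = (\<lambda>i. (y i, z i)) ` I"
  define leJ where "leJ p q \<longleftrightarrow> le (fst p) (fst q) \<and> le (snd q) (snd p)" for p q
  define s where "s = inv_into I (\<lambda>i. (y i, z i))"
  have s: "s p \<in> I" "y (s p) = fst p" "z (s p) = snd p" if "p \<in> J" for p
    using that inv_into_into[of p "\<lambda>i. (y i, z i)" I] f_inv_into_f[of p "\<lambda>i. (y i, z i)" I]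
    unfolding J_def s_def by (auto simp: prod_eq_iff)
  have JP: "fst p \<in> P \<and> snd p \<in> P" if "p \<in> J" for p
    using that yz by (auto simp: J_def)
  have "directed_index J leJ"
    unfolding directed_index_def
  proof (intro conjI ballI)
    show "J \<noteq> {}" using dir by (auto simp: J_def directed_index_def)
    show "reflp_on J leJ"
      using JP po(1) by (auto simp: reflp_on_def leJ_def)
    show "transp_on J leJ"
      using JP po(2) unfolding transp_on_def leJ_def by blast
    fix p q assume "p \<in> J" "q \<in> J"
    then obtain i j where ij: "i \<in> I" "j \<in> I" "p = (y i, z i)" "q = (y j, z j)"
      by (auto simp: J_def)
    then obtain k where "k \<in> I" "leI i k" "leI j k"
      using dir unfolding directed_index_def by blast
    then show "\<exists>c\<in>J. leJ p c \<and> leJ q c"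
      using ij y(1) z(1) unfolding J_def leJ_def monotone_on_def
      by (intro bexI[of _ "(y k, z k)"]) auto
  qed
  moreover have "x \<circ> s \<in> J \<rightarrow> C" using x s by auto
  moreover have "order_convergent P le J leJ (x \<circ> s) l"
    unfolding order_convergent_def
  proof (rule bexI[of _ fst], rule bexI[of _ snd], intro conjI ballI)
    show "fst \<in> J \<rightarrow> P" "snd \<in> J \<rightarrow> P" using JP by auto
    show "le (fst p) ((x \<circ> s) p)" "le ((x \<circ> s) p) (snd p)" if "p \<in> J" for p
      using le[OF s(1)[OF that]] s(2,3)[OF that] by auto
    show "monotone_on J leJ le fst" "monotone_on J leJ (\<lambda>a b. le b a) snd"
      by (auto simp: monotone_on_def leJ_def)
    show "is_sup_in P le (fst ` J) l" "is_inf_in P le (snd ` J) l"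
      using y(2) z(2) by (simp_all add: J_def image_image)
  qed
  ultimately show False
    using closed l \<open>l \<notin> C\<close> unfolding order_closed_def by blast
qed

definition poset_order_topology :: "'a set \<Rightarrow> ('a \<Rightarrow> 'a \<Rightarrow> bool) \<Rightarrow> 'a topology" where
  "poset_order_topology P le = topology (\<lambda>U. U \<subseteq> P \<and> order_closed P le (P - U))"

lemma order_closed_Int:
  assumes ne: "K \<noteq> {}" and K: "\<And>C. C \<in> K \<Longrightarrow> order_closed P le C"
  shows "order_closed P le (\<Inter>K)"
  unfolding order_closed_def
proof (intro conjI notI)
  show "\<Inter>K \<subseteq> P" using assms unfolding order_closed_def by blast
next
  assume "\<exists>(I :: ('a \<times> 'a) set) leI. directed_index I leI \<and>
          (\<exists>x\<in>I \<rightarrow> \<Inter>K. \<exists>l\<in>P - \<Inter>K. order_convergent P le I leI x l)"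
  then obtain I :: "('a \<times> 'a) set" and leI x l C where *: "directed_index I leI" "x \<in> I \<rightarrow> \<Inter>K"
    "l \<in> P" "C \<in> K" "l \<notin> C" "order_convergent P le I leI x l"
    by blast
  then have "x \<in> I \<rightarrow> C" by blast
  with * K[of C] show False unfolding order_closed_def by blast
qed

lemma order_convergent_cofinal:
  assumes tr: "transp_on P le" and J: "J \<subseteq> I"
    and cof: "\<And>i. i \<in> I \<Longrightarrow> \<exists>j\<in>J. leI i j"
    and conv: "order_convergent P le I leI x l"
  shows "order_convergent P le J leI x l"
proof -
  obtain y z where yz: "y \<in> I \<rightarrow> P" "z \<in> I \<rightarrow> P"
    and le: "\<forall>i\<in>I. le (y i) (x i) \<and> le (x i) (z i)"
    and y: "monotone_on I leI le y" "is_sup_in P le (y ` I) l"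
    and z: "monotone_on I leI (\<lambda>a b. le b a) z" "is_inf_in P le (z ` I) l"
    using conv unfolding order_convergent_def by blast
  have sup: "is_sup_in P r (w ` J) l"
    if "transp_on P r" "w \<in> I \<rightarrow> P" "monotone_on I leI r w" "is_sup_in P r (w ` I) l" for r w
    unfolding is_sup_in_def
  proof (intro conjI ballI impI)
    show "l \<in> P" "\<And>a. a \<in> w ` J \<Longrightarrow> r a l"
      using that(4) J unfolding is_sup_in_def by auto
    fix u assume u: "u \<in> P" "\<forall>a\<in>w ` J. r a u"
    have "r (w i) u" if i: "i \<in> I" for i
    proof -
      obtain j where j: "j \<in> J" "leI i j" using cof i by blast
      then have "r (w i) (w j)" "r (w j) u" "w i \<in> P" "w j \<in> P"
        using i u J \<open>monotone_on I leI r w\<close> \<open>w \<in> I \<rightarrow> P\<close> unfolding monotone_on_def by auto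
      then show ?thesis using \<open>transp_on P r\<close> u(1) unfolding transp_on_def by blast
    qed
    then show "r l u" using that(4) u(1) unfolding is_sup_in_def by auto
  qed
  have tr': "transp_on P (\<lambda>a b. le b a)" using tr unfolding transp_on_def by blast
  show ?thesis
    unfolding order_convergent_def
  proof (rule bexI[of _ y], rule bexI[of _ z], intro conjI)
    show "y \<in> J \<rightarrow> P" "z \<in> J \<rightarrow> P" "\<forall>i\<in>J. le (y i) (x i) \<and> le (x i) (z i)"
      using yz le J by auto
    show "monotone_on J leI le y" "monotone_on J leI (\<lambda>a b. le b a) z"
      using y z J by (auto intro: monotone_on_subset)
    show "is_sup_in P le (y ` J) l" using sup[OF tr yz(1) y] .
    show "is_inf_in P le (z ` J) l"
      using sup[OF tr' yz(2) z(1)] z(2) unfolding is_inf_in_def by blast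
  qed
qed

lemma order_closed_Un:
  assumes tr: "transp_on P le" and C: "order_closed P le C" and D: "order_closed P le D"
  shows "order_closed P le (C \<union> D)"
  unfolding order_closed_def
proof (intro conjI notI)
  show "C \<union> D \<subseteq> P" using C D unfolding order_closed_def by blast
next
  assume "\<exists>(I :: ('a \<times> 'a) set) leI. directed_index I leI \<and>
          (\<exists>x\<in>I \<rightarrow> C \<union> D. \<exists>l\<in>P - (C \<union> D). order_convergent P le I leI x l)"
  then obtain I :: "('a \<times> 'a) set" and leI x l where dir: "directed_index I leI"
    and x: "x \<in> I \<rightarrow> C \<union> D" and l: "l \<in> P - (C \<union> D)" and conv: "order_convergent P le I leI x l"
    by blast
  have False if E: "order_closed P le E" "l \<notin> E"
    and cof: "\<And>i. i \<in> I \<Longrightarrow> \<exists>j\<in>I. x j \<in> E \<and> leI i j" for E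
  proof -
    define J where "J = {j \<in> I. x j \<in> E}"
    have J: "J \<subseteq> I" "\<And>i. i \<in> I \<Longrightarrow> \<exists>j\<in>J. leI i j"
      using cof unfolding J_def by blast+
    have "directed_index J leI"
      unfolding directed_index_def
    proof (intro conjI ballI)
      show "J \<noteq> {}" using dir J(2) unfolding directed_index_def by blast
      show "reflp_on J leI" "transp_on J leI"
        using dir J(1) unfolding directed_index_def
        by (auto intro: reflp_on_subset transp_on_subset)
      fix a b assume "a \<in> J" "b \<in> J"
      then obtain c where c: "c \<in> I" "leI a c" "leI b c"
        using dir J(1) unfolding directed_index_def by blast
      then obtain d where d: "d \<in> J" "leI c d" using J(2) by blast
      have "transp_on I leI" using dir unfolding directed_index_def by blast
      then have "leI a d" "leI b d"
        using c d \<open>a \<in> J\<close> \<open>b \<in> J\<close> J(1) by (meson subsetD transp_onD)+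
      then show "\<exists>c\<in>J. leI a c \<and> leI b c" using d by blast
    qed
    moreover have "x \<in> J \<rightarrow> E" by (auto simp: J_def)
    moreover have "order_convergent P le J leI x l"
      using order_convergent_cofinal[OF tr J conv] .
    ultimately show False using E l unfolding order_closed_def by blast
  qed
  from this[OF C] this[OF D] l obtain i j where ij: "i \<in> I" "j \<in> I"
    "\<forall>k\<in>I. leI i k \<longrightarrow> x k \<notin> C" "\<forall>k\<in>I. leI j k \<longrightarrow> x k \<notin> D"
    by blast
  then obtain k where "k \<in> I" "leI i k" "leI j k"
    using dir unfolding directed_index_def by blast
  with ij x show False by blast
qed

text \<open>
  On a poset, \<open>poset_order_topology P le\<close> is the topology on \<open>P\<close> whose closed sets are exactly
  the order closed sets.
\<close>

lemma closedin_poset_order_topology: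
  assumes "transp_on P le"
  shows "closedin (poset_order_topology P le) C \<longleftrightarrow> order_closed P le C"
    and "topspace (poset_order_topology P le) = P"
proof -
  let ?op = "\<lambda>U. U \<subseteq> P \<and> order_closed P le (P - U)"
  have full: "order_closed P le P" unfolding order_closed_def by blast
  have empty: "order_closed P le {}" unfolding order_closed_def directed_index_def by blast
  have "istopology ?op"
    unfolding istopology_def
  proof (intro conjI allI impI)
    fix S T assume S: "?op S" and T: "?op T"
    have "P - S \<inter> T = (P - S) \<union> (P - T)" by blast
    then show "order_closed P le (P - S \<inter> T)" using order_closed_Un[OF assms] S T by simp
    show "S \<inter> T \<subseteq> P" using S by blast
  next
    fix K assume K: "\<forall>S\<in>K. ?op S"
    then show "\<Union>K \<subseteq> P" by blast
    show "order_closed P le (P - \<Union>K)"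
    proof (cases "K = {}")
      case False
      have "P - \<Union>K = \<Inter>((\<lambda>S. P - S) ` K)" using False by blast
      moreover have "order_closed P le (\<Inter>((\<lambda>S. P - S) ` K))"
        by (rule order_closed_Int) (use K False in auto)
      ultimately show ?thesis by (simp only:)
    qed (simp add: full)
  qed
  then have op: "openin (poset_order_topology P le) U \<longleftrightarrow> ?op U" for U
    by (simp add: poset_order_topology_def)
  have "openin (poset_order_topology P le) P" by (simp add: op empty)
  then show top: "topspace (poset_order_topology P le) = P"
    using op[of "topspace (poset_order_topology P le)"] openin_subset by blast
  show "closedin (poset_order_topology P le) C \<longleftrightarrow> order_closed P le C"
    unfolding closedin_def top op by (auto simp: double_diff order_closed_def)
qed

end

theory Submission
  imports Defs
begin

text \<open>
  The comparison of order topologies is pure order theory. Let \<open>X\<close> be a poset in which every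
  nonempty bounded set has a supremum and an infimum, and let \<open>Y \<subseteq> X\<close> contain the suprema and
  infima, taken in \<open>X\<close>, of its nonempty subsets. Bounds \<open>y i\<close>, \<open>z i\<close> in \<open>X\<close> of a net in \<open>Y\<close> can
  then be pushed inwards to the least element of \<open>Y\<close> above \<open>y i\<close> and the greatest element of \<open>Y\<close>
  below \<open>z i\<close>; these are still monotone and squeeze to the same limit, which lies in \<open>Y\<close>.
  Conversely, suprema and infima in \<open>Y\<close> are suprema and infima in \<open>X\<close>. So both posets have the
  same convergent nets in \<open>Y\<close>, and \<open>subtopology_poset_order_topology\<close> follows. All equalities
  of the theorem are instances with \<open>X = M\<close>, combined by transitivity of subspace topologies.

  That \<open>M\<close> is conditionally complete is \<open>star_sup_compression\<close>: if \<open>u\<close> is an upper bound of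
  \<open>L\<close> and \<open>q\<close> is the join of the right supports of the elements of \<open>L\<close>, then \<open>u q\<close> is the supremum
  of \<open>L\<close>. Here \<open>q \<in> M\<close> is the only place where strong closedness enters
  (\<open>support_projection\<close>).

  It remains to see that the four subsets are closed under suprema and infima. Partial isometries
  and projections are lower sets of the star order, and the adjoint is an order automorphism
  whose fixed points are the self-adjoint elements. A supremum \<open>s\<close> of partial isometries lies below
  the upper bound \<open>s s\<^sup>* s\<close>, and a supremum \<open>s\<close> of projections below \<open>s\<^sup>2\<close>, which
  forces \<open>s\<close> to be of the same kind. For a supremum \<open>s\<close> of positive elements and small \<open>e > 0\<close>, the vectors
  \<open>h\<close> for which \<open>(1 - e s)\<^sup>n h\<close> stays bounded form a subspace containing the
  ranges of those elements, and on it the quadratic form of \<open>s\<close> is nonnegative because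
  the norms of the iterates are log-convex (\<open>positives_sup_closed\<close>).
\<close>

section \<open>Orthogonal projections and adjoints in Hilbert space\<close>

text \<open>
  The point of \<open>W\<close> nearest to \<open>h\<close>. It exists because a minimizing sequence is Cauchy, and
  perturbing it inside \<open>W\<close> cannot decrease the distance, which gives orthogonality.
\<close>

lemma orthogonal_component_exists:
  fixes W :: "'a::{real_inner,complete_space} set"
  assumes W: "closed W" "subspace W"
  shows "\<exists>p\<in>W. \<forall>w\<in>W. inner (h - p) w = 0"
proof -
  define D where "D = (\<lambda>w. (norm (h - w))\<^sup>2) ` W"
  define d where "d = Inf D"
  have D: "D \<noteq> {}" "bdd_below D"
    using subspace_0[OF W(2)] by (auto simp: D_def intro!: bdd_belowI2[where m = 0])
  have d_le: "d \<le> (norm (h - w))\<^sup>2" if "w \<in> W" for w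
    unfolding d_def using that D by (auto simp: D_def intro!: cInf_lower)
  have "\<exists>w\<in>W. (norm (h - w))\<^sup>2 < d + 1 / real (Suc n)" for n
    using cInf_lessD[OF D(1), of "d + 1 / real (Suc n)"] by (auto simp: D_def d_def)
  then obtain w where w: "\<And>n. w n \<in> W" "\<And>n. (norm (h - w n))\<^sup>2 < d + 1 / real (Suc n)"
    by metis
  \<comment> \<open>The midpoint of two almost nearest points lies in \<open>W\<close>, so the parallelogram law makes them close.\<close>
  have close: "(norm (w m - w n))\<^sup>2 \<le> 2 / real (Suc m) + 2 / real (Suc n)" for m n
  proof -
    have "(1/2) *\<^sub>R (w m + w n) \<in> W" using W w by (simp add: subspace_add subspace_scale)
    from d_le[OF this] have "4 * d \<le> (2 * norm (h - (1/2) *\<^sub>R (w m + w n)))\<^sup>2"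
      by (simp add: power_mult_distrib)
    also have "2 * norm (h - (1/2) *\<^sub>R (w m + w n)) = norm ((h - w m) + (h - w n))"
      using norm_scaleR[of 2 "h - (1/2) *\<^sub>R (w m + w n)"]
      by (simp add: scaleR_diff_right scaleR_2 algebra_simps)
    finally have "4 * d \<le> (norm ((h - w m) + (h - w n)))\<^sup>2" .
    moreover have "(norm (w m - w n))\<^sup>2 = 2 * (norm (h - w m))\<^sup>2 + 2 * (norm (h - w n))\<^sup>2
        - (norm ((h - w m) + (h - w n)))\<^sup>2"
      by (simp add: power2_norm_eq_inner algebra_simps inner_commute)
    moreover have "2 / real (Suc m) = 2 * (1 / real (Suc m))" "2 / real (Suc n) = 2 * (1 / real (Suc n))"
      by simp_all
    ultimately show ?thesis using w(2)[of m] w(2)[of n] by linarith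
  qed
  have "Cauchy w"
  proof (rule metric_CauchyI)
    fix e :: real assume e: "0 < e"
    obtain N where N: "4 / e\<^sup>2 < real N" using reals_Archimedean2 by blast
    have "dist (w m) (w n) < e" if "N \<le> m" "N \<le> n" for m n
    proof -
      have pos: "0 < real N" using N e by (smt (verit) divide_pos_pos zero_less_power)
      have "(norm (w m - w n))\<^sup>2 \<le> 2 / real (Suc m) + 2 / real (Suc n)" by (rule close)
      also have "\<dots> \<le> 2 / real N + 2 / real N"
        using that pos by (intro add_mono divide_left_mono) auto
      also have "\<dots> < e\<^sup>2" using N pos e by (simp add: field_simps)
      finally show ?thesis using e by (simp add: dist_norm power_less_imp_less_base)
    qed
    then show "\<exists>N. \<forall>m\<ge>N. \<forall>n\<ge>N. dist (w m) (w n) < e" by blast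
  qed
  then obtain p where p: "w \<longlonglongrightarrow> p" using Cauchy_convergent_iff convergent_def by blast
  have pW: "p \<in> W" using closed_sequentially[OF W(1)] w(1) p by blast
  have "(\<lambda>n. (norm (h - w n))\<^sup>2) \<longlonglongrightarrow> (norm (h - p))\<^sup>2" by (intro tendsto_intros p)
  moreover have "(\<lambda>n. d + 1 / real (Suc n)) \<longlonglongrightarrow> d + 0"
    by (intro tendsto_intros LIMSEQ_inverse_real_of_nat[unfolded inverse_eq_divide])
  ultimately have pd: "(norm (h - p))\<^sup>2 \<le> d + 0"
    by (rule LIMSEQ_le) (use w(2) less_imp_le in blast)
  have "inner (h - p) v = 0" if v: "v \<in> W" for v
  proof (rule ccontr)
    assume c: "inner (h - p) v \<noteq> 0"
    then have vpos: "0 < (norm v)\<^sup>2" by auto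
    \<comment> \<open>The minimizer of \<open>norm (h - p - t *\<^sub>R v)\<close> over real \<open>t\<close>.\<close>
    define t where "t = inner (h - p) v / (norm v)\<^sup>2"
    have "p + t *\<^sub>R v \<in> W" using pW v W by (simp add: subspace_add subspace_scale)
    from d_le[OF this] pd have "(norm (h - p))\<^sup>2 \<le> (norm ((h - p) - t *\<^sub>R v))\<^sup>2"
      by (simp only: diff_diff_eq)
    also have "\<dots> = (norm (h - p))\<^sup>2 - 2 * t * inner (h - p) v + t\<^sup>2 * (norm v)\<^sup>2"
      using inner_commute[of v "h - p"] unfolding power2_norm_eq_inner
      by (simp only: inner_diff_left[of "h - p"] inner_diff_right[of _ "h - p"]) (simp add: power2_eq_square)
    also have "t\<^sup>2 * (norm v)\<^sup>2 = t * inner (h - p) v"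
      using vpos by (simp add: t_def power2_eq_square)
    finally have "t * inner (h - p) v \<le> 0" by simp
    moreover have "0 < t * inner (h - p) v"
      using c vpos by (simp add: t_def zero_less_mult_iff zero_less_divide_iff) (metis linorder_neqE)
    ultimately show False by simp
  qed
  with pW show ?thesis by blast
qed

text \<open>
  The kernel of \<open>f\<close> has codimension at most one, so a vector \<open>v\<close> orthogonal to it represents \<open>f\<close> up to
  a scalar.
\<close>

lemma riesz_representation:
  fixes f :: "'a::{real_inner,complete_space} \<Rightarrow> real"
  assumes f: "bounded_linear f"
  shows "\<exists>y. \<forall>h. f h = inner h y"
proof (cases "\<forall>h. f h = 0")
  case True
  then show ?thesis by (intro exI[of _ 0]) simp
next
  case False
  interpret bounded_linear f by (rule f)
  define N where "N = {h. f h = 0}"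
  have "closed N" unfolding N_def by (intro closed_Collect_eq continuous_intros isCont)
      (auto intro: linear_continuous_on[OF f])
  moreover have "subspace N" by (auto simp: N_def subspace_def zero add scaleR)
  moreover obtain u where u: "f u \<noteq> 0" using False by blast
  ultimately obtain p where p: "p \<in> N" "\<forall>w\<in>N. inner (u - p) w = 0"
    using orthogonal_component_exists by blast
  define v where "v = u - p"
  have fv: "f v \<noteq> 0" using u p(1) by (simp add: v_def diff N_def)
  then have v0: "inner v v \<noteq> 0" using zero by auto
  have "f h = inner h ((f v / inner v v) *\<^sub>R v)" for h
  proof -
    have "h - (f h / f v) *\<^sub>R v \<in> N" using fv by (simp add: N_def diff scaleR)
    then have "inner v (h - (f h / f v) *\<^sub>R v) = 0" using p(2) v_def by blast
    then have "inner v h = f h / f v * inner v v" by (simp add: inner_diff_right)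
    then show ?thesis using fv v0 by (simp add: inner_commute)
  qed
  then show ?thesis by blast
qed

lemma real_adjoint_exists:
  fixes x :: "'a::{real_inner,complete_space} \<Rightarrow>\<^sub>L 'a"
  shows "\<exists>y :: 'a \<Rightarrow>\<^sub>L 'a. \<forall>h k. inner (x h) k = inner h (y k)"
proof -
  have "\<exists>y. \<forall>h. inner (x h) k = inner h y" for k
    by (rule riesz_representation)
      (intro bounded_linear_compose[OF bounded_linear_inner_left] blinfun.bounded_linear_right)
  then obtain y where y: "\<And>h k. inner (x h) k = inner h (y k)" by metis
  have eqI: "a = b" if "\<And>h. inner h a = inner h b" for a b :: 'a
    using that by (metis vector_eq_rdot inner_commute)
  have "bounded_linear y"
  proof (rule bounded_linear_intro[where K = "norm x"])
    show "y (a + b) = y a + y b" for a b by (rule eqI) (simp add: y[symmetric] inner_add_right)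
    show "y (r *\<^sub>R a) = r *\<^sub>R y a" for r a by (rule eqI) (simp add: y[symmetric])
    show "norm (y k) \<le> norm k * norm x" for k
    proof -
      have "norm (y k) * norm (y k) = inner (x (y k)) k"
        using y[of "y k" k] by (simp add: power2_norm_eq_inner[symmetric] power2_eq_square)
      also have "\<dots> \<le> norm (x (y k)) * norm k" by (rule norm_cauchy_schwarz)
      also have "\<dots> \<le> (norm x * norm (y k)) * norm k"
        by (intro mult_right_mono norm_blinfun) simp
      finally have "norm (y k) * norm (y k) \<le> norm (y k) * (norm k * norm x)"
        by (simp add: mult_ac)
      then show ?thesis by (cases "norm (y k) = 0") auto
    qed
  qed
  then show ?thesis using y by (intro exI[of _ "Blinfun y"]) (simp add: bounded_linear_Blinfun_apply)
qed

lemma cbounded_opsD: "x \<in> cbounded_ops \<Longrightarrow> blinfun_apply x (c *\<^sub>C h) = c *\<^sub>C x h"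
  by (simp add: cbounded_ops_def)

lemma cinner_eq_inner:
  "cinner x y = Complex (inner x y) (- inner (\<i> *\<^sub>C x) y)" for x y :: "'h::complex_inner"
  by (simp add: inner_eq_Re_cinner cinner_scaleC_left complex_eq_iff)

text \<open>
  The real inner product determines the complex one, so an adjoint for the former is an adjoint
  for the latter; from here on adjoints are handled through the real inner product alone.
\<close>

lemma adj_eqI_real:
  assumes x: "x \<in> cbounded_ops" and y: "\<And>h k. inner (blinfun_apply x h) k = inner h (blinfun_apply y k)"
  shows "adj x = y"
  by (rule adj_eqI) (use y in \<open>simp add: cinner_eq_inner cbounded_opsD[OF x, symmetric]\<close>)

lemma inner_adj_right:
  assumes x: "x \<in> cbounded_ops"
  shows "inner h (blinfun_apply (adj x) k) = inner (blinfun_apply x h) k"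
proof -
  obtain y :: "'a \<Rightarrow>\<^sub>L 'a" where y: "\<forall>h k. inner (x h) k = inner h (y k)"
    using real_adjoint_exists by blast
  then have "adj x = y" using adj_eqI_real[OF x] by blast
  with y show ?thesis by simp
qed

lemma inner_adj_left:
  assumes "x \<in> cbounded_ops"
  shows "inner (blinfun_apply (adj x) h) k = inner h (blinfun_apply x k)"
  using inner_adj_right[OF assms, of k h] by (simp add: inner_commute)

lemma inner_scaleC_right: "inner x (c *\<^sub>C y) = inner (cnj c *\<^sub>C x) y" for x y :: "'h::complex_inner"
  by (metis cinner_commute cinner_scaleC_left complex_cnj_mult inner_eq_Re_cinner)

lemma inner_eq_imp_eq: "(\<And>h. inner h a = inner h b) \<Longrightarrow> a = b" for a b :: "'a::real_inner"
  by (metis vector_eq_rdot inner_commute)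

lemma adj_in_cbounded_ops:
  assumes x: "x \<in> cbounded_ops"
  shows "adj x \<in> cbounded_ops"
proof -
  have "adj x (c *\<^sub>C k) = c *\<^sub>C adj x k" for c k
    by (rule inner_eq_imp_eq)
      (simp add: inner_adj_right[OF x] inner_scaleC_right cbounded_opsD[OF x, symmetric])
  then show ?thesis by (simp add: cbounded_ops_def)
qed

lemma adj_adj: "x \<in> cbounded_ops \<Longrightarrow> adj (adj x) = x"
  by (rule adj_eqI_real[OF adj_in_cbounded_ops]) (simp_all add: inner_adj_left)

lemma orthogonal_projection_exists:
  fixes W :: "'h::chilbert_space set"
  assumes W: "closed W" "subspace W" and cW: "\<And>c w. w \<in> W \<Longrightarrow> c *\<^sub>C w \<in> W"
  obtains q :: "'h \<Rightarrow>\<^sub>L 'h" where "q \<in> cbounded_ops" "\<And>h. q h \<in> W" "\<And>h w. w \<in> W \<Longrightarrow> inner (h - q h) w = 0"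
    "\<And>h p. p \<in> W \<Longrightarrow> (\<And>w. w \<in> W \<Longrightarrow> inner (h - p) w = 0) \<Longrightarrow> q h = p"
proof -
  obtain q where q: "\<And>h. q h \<in> W" "\<And>h w. w \<in> W \<Longrightarrow> inner (h - q h) w = 0"
    using orthogonal_component_exists[OF W] by metis
  have eqI: "q h = p" if "p \<in> W" "\<And>w. w \<in> W \<Longrightarrow> inner (h - p) w = 0" for h p
  proof -
    have "q h - p \<in> W" using q(1) that(1) W(2) by (simp add: subspace_diff)
    with q(2)[OF this, of h] that(2)[OF this] have "inner (q h - p) (q h - p) = 0"
      by (simp add: inner_diff_left)
    then show ?thesis by simp
  qed
  have "bounded_linear q"
  proof (rule bounded_linear_intro[where K = 1])
    show "q (a + b) = q a + q b" for a b
    proof (rule eqI)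
      fix w assume w: "w \<in> W"
      have "a + b - (q a + q b) = (a - q a) + (b - q b)" by simp
      then show "inner (a + b - (q a + q b)) w = 0" using q(2)[OF w] by (simp only: inner_add_left)
    qed (use q(1) W(2) in \<open>simp add: subspace_add\<close>)
    show "q (r *\<^sub>R a) = r *\<^sub>R q a" for r a
    proof (rule eqI)
      fix w assume w: "w \<in> W"
      show "inner (r *\<^sub>R a - r *\<^sub>R q a) w = 0"
        using q(2)[OF w, of a] by (simp add: scaleR_diff_right[symmetric])
    qed (use q(1) W(2) in \<open>simp add: subspace_scale\<close>)
    show "norm (q h) \<le> norm h * 1" for h
    proof -
      have "norm (q h) * norm (q h) = inner h (q h)"
        using q(2)[OF q(1)[of h], of h]
        by (simp add: inner_diff_left power2_norm_eq_inner[symmetric] power2_eq_square)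
      also have "\<dots> \<le> norm h * norm (q h)" by (rule norm_cauchy_schwarz)
      finally show ?thesis by (cases "norm (q h) = 0") auto
    qed
  qed
  then have Q: "blinfun_apply (Blinfun q) = q" by (rule bounded_linear_Blinfun_apply)
  have "q (c *\<^sub>C h) = c *\<^sub>C q h" for c h
  proof (rule eqI)
    fix w assume w: "w \<in> W"
    have "inner w (c *\<^sub>C h - c *\<^sub>C q h) = inner (cnj c *\<^sub>C w) (h - q h)"
      by (simp only: inner_diff_right inner_scaleC_right)
    also have "\<dots> = inner (h - q h) (cnj c *\<^sub>C w)" by (rule inner_commute)
    also have "\<dots> = 0" by (rule q(2)[OF cW[OF w]])
    finally have "inner w (c *\<^sub>C h - c *\<^sub>C q h) = 0" .
    then show "inner (c *\<^sub>C h - c *\<^sub>C q h) w = 0" by (simp only: inner_commute)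
  qed (use cW q(1) in blast)
  then have "Blinfun q \<in> cbounded_ops" by (simp add: cbounded_ops_def Q)
  then show thesis by (rule that[of "Blinfun q", unfolded Q, OF _ q eqI])
qed

section \<open>Iterating a self-adjoint operator\<close>

text \<open>
  One step \<open>1 - e x\<close> of Richardson's iteration for the equation \<open>x h = 0\<close>. For self-adjoint \<open>x\<close> and
  \<open>e * norm x \<le> 1\<close> its powers annihilate in the limit the part of a vector where \<open>x\<close> is positive, fix the
  kernel of \<open>x\<close>, and blow up the part where \<open>x\<close> is negative. Both uses below rest on this
  dichotomy: computing support projections and detecting positivity.
\<close>

definition richardson :: "real \<Rightarrow> ('a::real_normed_vector \<Rightarrow>\<^sub>L 'a) \<Rightarrow> 'a \<Rightarrow> 'a" where
  "richardson e x h = h - e *\<^sub>R x h"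

lemma bounded_linear_richardson_power: "bounded_linear (richardson e x ^^ n)"
proof (induction n)
  case 0
  show ?case by (simp add: id_def bounded_linear_ident)
next
  case (Suc n)
  have "bounded_linear (\<lambda>h. h - e *\<^sub>R x h)"
    by (intro bounded_linear_sub bounded_linear_ident bounded_linear_const_scaleR blinfun.bounded_linear_right)
  then have "bounded_linear (richardson e x)" by (simp add: richardson_def[abs_def])
  from bounded_linear_compose[OF this Suc.IH] show ?case by (simp add: o_def)
qed

lemma inner_richardson_power:
  assumes "\<And>h k. inner (blinfun_apply x h) k = inner h (blinfun_apply x k)"
  shows "inner ((richardson e x ^^ n) h) k = inner h ((richardson e x ^^ n) k)"
proof (induction n arbitrary: h k)
  case (Suc n)
  have "inner (richardson e x h) k = inner h (richardson e x k)" for h k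
    by (simp add: richardson_def inner_diff_left inner_diff_right assms)
  then show ?case using Suc.IH by (simp add: funpow_swap1)
qed simp

text \<open>
  Cauchy--Schwarz for the semi-inner product \<open>inner (x h) k\<close>, applied to \<open>h\<close> and \<open>k = x h\<close>.
\<close>

lemma norm_square_le_positive:
  fixes x :: "'a::real_inner \<Rightarrow>\<^sub>L 'a"
  assumes sym: "\<And>h k. inner (x h) k = inner h (x k)" and pos: "\<And>h. 0 \<le> inner (x h) h"
  shows "(norm (x h))\<^sup>2 \<le> norm x * inner (x h) h"
proof (cases "norm x = 0")
  case False
  define t where "t = inverse (norm x)"
  have t: "0 \<le> t" "t * norm x = 1" using False by (simp_all add: t_def)
  define k where "k = x h"
  have "0 \<le> inner (x (h - t *\<^sub>R k)) (h - t *\<^sub>R k)" by (rule pos)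
  also have "\<dots> = inner (x h) h - 2 * t * (norm k)\<^sup>2 + t\<^sup>2 * inner (x k) k"
    using sym[of k h] inner_commute[of h k] unfolding power2_norm_eq_inner
    by (simp add: blinfun.diff_right blinfun.scaleR_right inner_diff_left inner_diff_right
        power2_eq_square k_def[symmetric] right_diff_distrib)
  also have "inner (x k) k \<le> norm x * (norm k)\<^sup>2"
    using norm_cauchy_schwarz[of "x k" k] mult_right_mono[OF norm_blinfun[of x k], of "norm k"]
    by (simp add: power2_eq_square mult_ac)
  then have "t\<^sup>2 * inner (x k) k \<le> t\<^sup>2 * (norm x * (norm k)\<^sup>2)" by (rule mult_left_mono) simp
  also have "t\<^sup>2 * (norm x * (norm k)\<^sup>2) = t * (t * norm x) * (norm k)\<^sup>2"
    by (simp add: power2_eq_square)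
  finally have "t * (norm k)\<^sup>2 \<le> inner (x h) h" by (simp add: t)
  then have "norm x * (t * (norm k)\<^sup>2) \<le> norm x * inner (x h) h" by (rule mult_left_mono) simp
  also have "norm x * (t * (norm k)\<^sup>2) = t * norm x * (norm k)\<^sup>2" by simp
  finally show ?thesis using t by (simp add: k_def)
qed simp

lemma norm_richardson_le:
  fixes x :: "'a::real_inner \<Rightarrow>\<^sub>L 'a"
  assumes sym: "\<And>h k. inner (x h) k = inner h (x k)" and pos: "\<And>h. 0 \<le> inner (x h) h"
    and e: "0 \<le> e" "e * norm x \<le> 1"
  shows "(norm (richardson e x h))\<^sup>2 \<le> (norm h)\<^sup>2 - e * inner (x h) h"
proof -
  have "e * (e * (norm (x h))\<^sup>2) \<le> e * (e * (norm x * inner (x h) h))"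
    using e by (intro mult_left_mono norm_square_le_positive sym pos) auto
  also have "\<dots> = e * ((e * norm x) * inner (x h) h)" by simp
  also have "\<dots> \<le> e * (1 * inner (x h) h)"
    using e pos by (intro mult_left_mono mult_right_mono) auto
  finally have "e * (e * (norm (x h))\<^sup>2) \<le> e * inner (x h) h" by simp
  moreover have "(norm (richardson e x h))\<^sup>2 = (norm h)\<^sup>2 - 2 * e * inner (x h) h + e * (e * (norm (x h))\<^sup>2)"
    unfolding power2_norm_eq_inner
    by (simp add: richardson_def inner_diff_left inner_diff_right inner_commute)
  ultimately show ?thesis by simp
qed

lemma norm_richardson_power_le:
  fixes x :: "'a::real_inner \<Rightarrow>\<^sub>L 'a"
  assumes sym: "\<And>h k. inner (x h) k = inner h (x k)" and pos: "\<And>h. 0 \<le> inner (x h) h"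
    and e: "0 \<le> e" "e * norm x \<le> 1"
  shows "norm ((richardson e x ^^ n) h) \<le> norm h"
proof (induction n)
  case (Suc n)
  have "(norm (richardson e x g))\<^sup>2 \<le> (norm g)\<^sup>2" for g
    using norm_richardson_le[OF assms, of g] mult_nonneg_nonneg[OF e(1) pos[of g]] by linarith
  then have "norm (richardson e x g) \<le> norm g" for g by (rule power2_le_imp_le) simp
  from order_trans[OF this Suc.IH] show ?case by simp
qed simp

text \<open>
  Each step of the iteration costs at least \<open>e * inner (a g) g\<close> of the squared norm, so these
  quantities tend to zero along the orbit. If \<open>a\<close> dominates \<open>y\<^sup>* y\<close>, this forces \<open>y\<close> to tend to
  zero along the orbit, and self-adjointness of the iteration turns that into decay of the orbit
  itself when it starts in the range of \<open>y\<^sup>*\<close>.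
\<close>

lemma richardson_power_tendsto_0:
  fixes a :: "'h::chilbert_space \<Rightarrow>\<^sub>L 'h"
  assumes sym: "\<And>h k. inner (a h) k = inner h (a k)"
    and e: "0 < e" "e * norm a \<le> 1"
    and y: "y \<in> cbounded_ops" and dom: "\<And>h. (norm (blinfun_apply y h))\<^sup>2 \<le> inner (a h) h"
  shows "(\<lambda>n. (richardson e a ^^ n) (adj y k)) \<longlonglongrightarrow> 0"
proof -
  have pos: "0 \<le> inner (a h) h" for h using order_trans[OF _ dom] by simp
  define g where "g = adj y k"
  define r where "r n = (richardson e a ^^ n) g" for n
  define b where "b n = (norm (r n))\<^sup>2" for n
  have step: "e * inner (a (r n)) (r n) \<le> b n - b (Suc n)" for n
    using norm_richardson_le[OF sym pos _ e(2), of "r n"] e(1) by (simp add: b_def r_def)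
  have "e * 0 \<le> e * inner (a (r n)) (r n)" for n using pos e(1) by (intro mult_left_mono) auto
  then have dec: "b (Suc n) \<le> b n" for n using step[of n] by (smt (verit) mult_zero_right)
  then have "decseq b" by (simp add: decseq_Suc_iff)
  moreover have "bdd_below (range b)" by (auto simp: b_def intro!: bdd_belowI2[where m = 0])
  ultimately obtain l where "b \<longlonglongrightarrow> l" using LIMSEQ_decseq_INF by blast
  then have "(\<lambda>n. b n - b (Suc n)) \<longlonglongrightarrow> l - l" by (intro tendsto_intros LIMSEQ_Suc)
  then have "(\<lambda>n. (b n - b (Suc n)) / e) \<longlonglongrightarrow> 0" using tendsto_divide_zero[of _ _ e] by simp
  then have "(\<lambda>n. (norm (y (r n)))\<^sup>2) \<longlonglongrightarrow> 0"
  proof (rule tendsto_sandwich[OF _ _ tendsto_const, rotated 2])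
    have "(norm (y (r n)))\<^sup>2 \<le> (b n - b (Suc n)) / e" for n
    proof -
      have "e * (norm (y (r n)))\<^sup>2 \<le> e * inner (a (r n)) (r n)"
        using dom e(1) by (intro mult_left_mono) auto
      from order_trans[OF this step[of n]] show ?thesis using e(1) by (simp add: pos_le_divide_eq mult.commute)
    qed
    then show "\<forall>\<^sub>F n in sequentially. (norm (y (r n)))\<^sup>2 \<le> (b n - b (Suc n)) / e" by simp
  qed simp
  then have "(\<lambda>n. sqrt ((norm (y (r n)))\<^sup>2)) \<longlonglongrightarrow> sqrt 0" by (rule tendsto_real_sqrt)
  then have "(\<lambda>n. norm (y (r n))) \<longlonglongrightarrow> 0" by simp
  then have lim: "(\<lambda>n. norm (y (r (n + n))) * norm k) \<longlonglongrightarrow> 0"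
    using LIMSEQ_subseq_LIMSEQ[of "\<lambda>n. norm (y (r n))" 0 "\<lambda>n. n + n"]
    by (intro tendsto_mult_left_zero) (simp add: strict_mono_def o_def)
  have "b n \<le> norm (y (r (n + n))) * norm k" for n
  proof -
    have "b n = inner (r n) (r n)" by (simp add: b_def power2_norm_eq_inner)
    also have "\<dots> = inner (r (n + n)) g"
      using inner_richardson_power[of a n e "r n" g, OF sym] by (simp add: r_def funpow_add)
    also have "\<dots> = inner (y (r (n + n))) k" by (simp add: g_def inner_adj_right[OF y])
    finally show ?thesis using norm_cauchy_schwarz by simp
  qed
  then have "(\<lambda>n. (norm (r n))\<^sup>2) \<longlonglongrightarrow> 0"
    by (intro tendsto_sandwich[OF _ _ tendsto_const lim]) (auto simp: b_def)
  then have "(\<lambda>n. sqrt ((norm (r n))\<^sup>2)) \<longlonglongrightarrow> sqrt 0" by (rule tendsto_real_sqrt)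
  then have "(\<lambda>n. norm (r n)) \<longlonglongrightarrow> 0" by simp
  then show ?thesis by (simp add: tendsto_norm_zero_iff r_def g_def)
qed

text \<open>
  Cauchy--Schwarz makes the norms of the iterates log-convex, so a bounded orbit cannot
  grow in its first step.
\<close>

lemma bounded_richardson_orbit_imp_nonneg:
  fixes s :: "'a::real_inner \<Rightarrow>\<^sub>L 'a"
  assumes sym: "\<And>h k. inner (s h) k = inner h (s k)" and e: "0 < e"
    and bdd: "\<And>n. norm ((richardson e s ^^ n) h) \<le> B"
  shows "0 \<le> inner (s h) h"
proof -
  define b where "b n = norm ((richardson e s ^^ n) h)" for n
  have convex: "b (Suc n) * b (Suc n) \<le> b n * b (Suc (Suc n))" for n
  proof -
    define g where "g = (richardson e s ^^ n) h"
    have "b (Suc n) * b (Suc n) = inner (richardson e s g) (richardson e s g)"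
      by (simp add: b_def g_def power2_norm_eq_inner[symmetric] power2_eq_square)
    also have "\<dots> = inner g (richardson e s (richardson e s g))"
      using inner_richardson_power[of s 1 e g "richardson e s g", OF sym] by simp
    also have "\<dots> \<le> b n * b (Suc (Suc n))"
      using norm_cauchy_schwarz by (simp add: b_def g_def)
    finally show ?thesis .
  qed
  have "b 1 \<le> b 0"
  proof (rule ccontr)
    assume grow: "\<not> b 1 \<le> b 0"
    have b0: "b 0 > 0"
    proof (rule ccontr)
      assume "\<not> b 0 > 0"
      then have "h = 0" by (simp add: b_def)
      with grow show False by (simp add: b_def richardson_def blinfun.zero_right)
    qed
    define c where "c = b 1 / b 0"
    have c: "c > 1" using grow b0 by (simp add: c_def)
    have ratio: "b n > 0 \<and> c * b n \<le> b (Suc n)" for n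
    proof (induction n)
      case 0
      then show ?case using b0 by (simp add: c_def)
    next
      case (Suc n)
      then have pos: "b (Suc n) > 0" using c by (smt (verit) mult_pos_pos)
      have "b n * (c * b (Suc n)) = c * b n * b (Suc n)" by simp
      also have "\<dots> \<le> b (Suc n) * b (Suc n)" using Suc pos by (intro mult_right_mono) auto
      also have "\<dots> \<le> b n * b (Suc (Suc n))" by (rule convex)
      finally show ?case using Suc pos by simp
    qed
    have "c ^ n * b 0 \<le> b n" for n
    proof (induction n)
      case (Suc n)
      have "c ^ Suc n * b 0 = c * (c ^ n * b 0)" by simp
      also have "\<dots> \<le> c * b n" using Suc c by (intro mult_left_mono) auto
      also have "\<dots> \<le> b (Suc n)" using ratio by blast
      finally show ?case .
    qed simp
    moreover obtain n where "B / b 0 < c ^ n" using real_arch_pow[OF c] by blast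
    ultimately have "B < b n" using b0 by (smt (verit) pos_divide_less_eq)
    then show False using bdd[of n] by (simp add: b_def)
  qed
  then have le: "norm (richardson e s h) \<le> norm h" by (simp add: b_def)
  have "inner (richardson e s h) h \<le> norm (richardson e s h) * norm h" by (rule norm_cauchy_schwarz)
  also have "\<dots> \<le> norm h * norm h" using le by (rule mult_right_mono) simp
  also have "\<dots> = inner h h" by (simp add: power2_norm_eq_inner[symmetric] power2_eq_square)
  finally have "0 \<le> e * inner (s h) h" by (simp add: richardson_def inner_diff_left)
  then show ?thesis using e by (simp add: zero_le_mult_iff)
qed

section \<open>Support projections in a von Neumann algebra\<close>

lemma subspace_closure:
  fixes S :: "'a::real_normed_vector set"
  assumes "subspace S"
  shows "subspace (closure S)"
  unfolding subspace_def
proof (intro conjI ballI allI)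
  show "0 \<in> closure S" using subspace_0[OF assms] closure_subset by blast
  fix x y assume "x \<in> closure S" "y \<in> closure S"
  then obtain f g where fg: "\<And>n. f n \<in> S" "f \<longlonglongrightarrow> x" "\<And>n. g n \<in> S" "g \<longlonglongrightarrow> y"
    unfolding closure_sequential by blast
  then have "\<And>n. f n + g n \<in> S" "(\<lambda>n. f n + g n) \<longlonglongrightarrow> x + y"
    using subspace_add[OF assms] by (blast, intro tendsto_add)
  then show "x + y \<in> closure S" unfolding closure_sequential by (intro exI[of _ "\<lambda>n. f n + g n"]) simp
next
  fix c x assume x: "x \<in> closure S"
  have "(\<lambda>x. c *\<^sub>R x) ` closure S \<subseteq> closure ((\<lambda>x. c *\<^sub>R x) ` S)"
    by (rule closure_bounded_linear_image_subset) (rule bounded_linear_scaleR_right)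
  also have "\<dots> \<subseteq> closure S" using subspace_scale[OF assms] by (intro closure_mono) auto
  finally show "c *\<^sub>R x \<in> closure S" using x by blast
qed

lemma bounded_linear_scaleC: "bounded_linear (\<lambda>h :: 'h::complex_inner. c *\<^sub>C h)"
  by (rule bounded_linear_intro[where K = "cmod c"])
    (simp_all add: scaleC_add_right scaleR_eq_scaleC scaleC_scaleC mult.commute norm_scaleC)

lemma von_neumann_algebraD:
  assumes "von_neumann_algebra M"
  shows "M \<subseteq> cbounded_ops" "0 \<in> M" "x \<in> M \<Longrightarrow> y \<in> M \<Longrightarrow> x + y \<in> M"
    "x \<in> M \<Longrightarrow> r *\<^sub>R x \<in> M" "x \<in> M \<Longrightarrow> y \<in> M \<Longrightarrow> x - y \<in> M"
    "x \<in> M \<Longrightarrow> y \<in> M \<Longrightarrow> x o\<^sub>L y \<in> M" "x \<in> M \<Longrightarrow> adj x \<in> M"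
proof -
  have "cstar_subalgebra M" using assms by (simp add: von_neumann_algebra_def)
  then show 1: "M \<subseteq> cbounded_ops" "0 \<in> M" "x \<in> M \<Longrightarrow> y \<in> M \<Longrightarrow> x + y \<in> M"
    "x \<in> M \<Longrightarrow> y \<in> M \<Longrightarrow> x o\<^sub>L y \<in> M" "x \<in> M \<Longrightarrow> adj x \<in> M" for x y
    by (auto simp: cstar_subalgebra_def)
  have "r *\<^sub>R x = scaleC_op (complex_of_real r) x" for r and x :: "'a \<Rightarrow>\<^sub>L 'a"
    by (rule blinfun_eqI) (simp add: scaleC_op_apply scaleR_eq_scaleC blinfun.scaleR_left)
  then show 2: "x \<in> M \<Longrightarrow> r *\<^sub>R x \<in> M" for r x
    using \<open>cstar_subalgebra M\<close> by (simp add: cstar_subalgebra_def)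
  show "x \<in> M \<Longrightarrow> y \<in> M \<Longrightarrow> x - y \<in> M" using 1(3)[of x "(-1) *\<^sub>R y"] 2[of y "-1"] by simp
qed

text \<open>
  A basic strong neighbourhood of \<open>q\<close> constrains the values at finitely many vectors only, so it
  is enough to approximate \<open>q\<close> uniformly on finite sets of vectors.
\<close>

lemma von_neumann_algebra_strongly_closed:
  assumes M: "von_neumann_algebra M" and q: "q \<in> cbounded_ops"
    and approx: "\<And>F e. finite F \<Longrightarrow> 0 < e \<Longrightarrow> \<exists>a\<in>M. \<forall>h\<in>F. norm (blinfun_apply a h - blinfun_apply q h) < e"
  shows "q \<in> M"
proof (rule ccontr)
  assume "q \<notin> M"
  have "closedin (subtopology strong_operator_topology cbounded_ops) M"
    using M by (simp add: von_neumann_algebra_def)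
  then have "openin (subtopology strong_operator_topology cbounded_ops) (cbounded_ops - M)"
    by (simp add: closedin_def strong_operator_topology_topspace)
  then obtain U where U: "openin strong_operator_topology U" "cbounded_ops - M = U \<inter> cbounded_ops"
    by (auto simp: openin_subtopology)
  then obtain V where V: "open V" "U = blinfun_apply -` V"
    unfolding strong_operator_topology_def openin_pullback_topology by auto
  have "blinfun_apply q \<in> V" using U V q \<open>q \<notin> M\<close> by blast
  then obtain X where X: "\<And>i. blinfun_apply q i \<in> X i" "\<And>i. open (X i)" "finite {i. X i \<noteq> UNIV}" "Pi\<^sub>E UNIV X \<subseteq> V"
    using product_topology_open_contains_basis[of "\<lambda>i. euclidean" UNIV V "blinfun_apply q"] V(1)
    by (auto simp: open_fun_def PiE_UNIV_domain)
  have "\<exists>e>0. ball (q i) e \<subseteq> X i" for i using X(1,2) open_contains_ball by blast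
  then obtain e where e: "\<And>i. 0 < e i" "\<And>i. ball (q i) (e i) \<subseteq> X i" by metis
  let ?F = "{i. X i \<noteq> UNIV}"
  define d where "d = Min (insert 1 (e ` ?F))"
  have "0 < d" unfolding d_def using X(3) e(1) by (subst Min_gr_iff) auto
  then obtain a where a: "a \<in> M" "\<And>h. h \<in> ?F \<Longrightarrow> norm (blinfun_apply a h - q h) < d" using approx[OF X(3)] by blast
  have "blinfun_apply a i \<in> X i" for i
  proof (cases "i \<in> ?F")
    case True
    then have "d \<le> e i" unfolding d_def using X(3) by (intro Min_le) auto
    then have "a i \<in> ball (q i) (e i)" using a(2)[OF True] by (simp add: dist_norm norm_minus_commute)
    then show ?thesis using e(2) by blast
  qed auto
  then have "blinfun_apply a \<in> V" using X(4) by (auto simp: PiE_UNIV_domain)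
  then have "a \<in> U" using V(2) by simp
  moreover have "a \<in> cbounded_ops" using a(1) von_neumann_algebraD(1)[OF M] by blast
  ultimately show False using U(2) a(1) by blast
qed

lemma one_minus_richardson_power_in_algebra:
  assumes M: "von_neumann_algebra M" and a: "a \<in> M"
  shows "\<exists>t\<in>M. \<forall>h. blinfun_apply t h = h - (richardson e a ^^ n) h"
proof (induction n)
  case 0
  show ?case using von_neumann_algebraD(2)[OF M] by (intro bexI[of _ 0]) auto
next
  case (Suc n)
  then obtain t where t: "t \<in> M" "\<And>h. t h = h - (richardson e a ^^ n) h" by blast
  then have r: "(richardson e a ^^ n) h = h - t h" for h by simp
  have "t + e *\<^sub>R (a - (a o\<^sub>L t)) \<in> M" by (intro von_neumann_algebraD[OF M] t a)
  then show ?case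
    by (rule bexI[rotated])
      (simp add: r richardson_def[of e a "_ - _"] blinfun.add_left blinfun.diff_left blinfun.scaleR_left
        blinfun.diff_right algebra_simps)
qed

lemma sum_adj_compose_self:
  assumes M: "von_neumann_algebra M" and J: "finite J" "J \<subseteq> M"
  shows "\<exists>a\<in>M. (\<forall>h k. inner (blinfun_apply a h) k = (\<Sum>y\<in>J. inner (blinfun_apply y h) (y k)))"
proof -
  have "(\<Sum>y\<in>J. adj y o\<^sub>L y) \<in> M"
    using J by (induction J rule: finite_induct) (auto intro: von_neumann_algebraD[OF M])
  moreover have "inner ((\<Sum>y\<in>J. adj y o\<^sub>L y) h) k = (\<Sum>y\<in>J. inner (blinfun_apply y h) (y k))" for h k
    using J(2) von_neumann_algebraD(1)[OF M]
    by (auto simp: blinfun.sum_left inner_sum_left inner_adj_left intro!: sum.cong)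
  ultimately show ?thesis by blast
qed

lemma span_finite_support:
  assumes "g \<in> span (\<Union>y\<in>L. range (f y))"
  shows "\<exists>J. finite J \<and> J \<subseteq> L \<and> g \<in> span (\<Union>y\<in>J. range (f y))"
  using assms
proof (induction rule: span_induct_alt)
  case base
  then show ?case by (intro exI[of _ "{}"]) (simp add: span_zero)
next
  case (step c x g)
  then obtain y J where J: "y \<in> L" "x \<in> range (f y)" "finite J" "J \<subseteq> L" "g \<in> span (\<Union>y\<in>J. range (f y))"
    by blast
  have "g \<in> span (\<Union>y\<in>insert y J. range (f y))"
    using J(5) span_mono[of "\<Union>y\<in>J. range (f y)" "\<Union>y\<in>insert y J. range (f y)"] by auto
  moreover have "x \<in> span (\<Union>y\<in>insert y J. range (f y))" using J(2) by (intro span_base) auto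
  ultimately show ?case
    using J by (intro exI[of _ "insert y J"]) (auto intro: span_add span_scale)
qed

text \<open>
  The join \<open>q\<close> of the right supports of the elements of \<open>L\<close>, that is, the projection onto the
  closed span of the ranges of \<open>y\<^sup>*\<close>, \<open>y \<in> L\<close>. It lies in the algebra because it is
  approximated strongly by \<open>1 - (1 - e a)\<^sup>n\<close>, where \<open>a\<close> is a finite sum of operators
  \<open>y\<^sup>* y\<close>: these are polynomials in \<open>a\<close> without constant term, so they stay in the algebra
  even if its unit is not the identity operator. On finitely many vectors, finitely many \<open>y\<close>
  suffice to approximate the values of \<open>q\<close> by linear combinations of vectors \<open>y\<^sup>* k\<close>, and on those
  \<open>(1 - e a)\<^sup>n\<close> tends to zero.
\<close>

lemma support_projection:
  fixes M :: "('h::chilbert_space \<Rightarrow>\<^sub>L 'h) set"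
  assumes M: "von_neumann_algebra M" and L: "L \<subseteq> M"
  obtains q where "q \<in> M" "\<And>h k. inner (q h) k = inner h (q k)"
    "\<And>h. blinfun_apply q h \<in> closure (span (\<Union>y\<in>L. range (blinfun_apply (adj y))))"
    "\<And>h. (\<And>y. y \<in> L \<Longrightarrow> blinfun_apply y h = 0) \<Longrightarrow> q h = 0"
    "\<And>y h. y \<in> L \<Longrightarrow> blinfun_apply y (q h) = y h"
proof -
  let ?A = "\<Union>y\<in>L. range (blinfun_apply (adj y))"
  define W where "W = closure (span ?A)"
  have LC: "y \<in> cbounded_ops" if "y \<in> L" for y using that L von_neumann_algebraD(1)[OF M] by blast
  have AW: "span ?A \<subseteq> W" by (simp add: W_def closure_subset)
  have cl: "closed W" by (simp add: W_def)
  have sW: "subspace W" unfolding W_def by (intro subspace_closure subspace_span)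
  have cspan: "c *\<^sub>C g \<in> span ?A" if "g \<in> span ?A" for c g
    using that
  proof (induction rule: span_induct_alt)
    case base
    have "c *\<^sub>C (0::'h) = 0" using linear_simps(3)[OF bounded_linear_scaleC] by blast
    then show ?case by (simp add: span_zero)
  next
    case (step r x g)
    then obtain y k where y: "y \<in> L" "x = adj y k" by blast
    then have "c *\<^sub>C x = adj y (c *\<^sub>C k)" by (simp add: cbounded_opsD adj_in_cbounded_ops LC)
    then have "c *\<^sub>C x \<in> span ?A" using y(1) by (auto intro: span_base)
    moreover have "c *\<^sub>C (r *\<^sub>R x + g) = r *\<^sub>R (c *\<^sub>C x) + c *\<^sub>C g"
      by (simp add: scaleC_add_right scaleR_eq_scaleC scaleC_scaleC mult.commute)
    ultimately show ?case using step by (simp add: span_add span_scale)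
  qed
  have cW: "c *\<^sub>C w \<in> W" if "w \<in> W" for c w
  proof -
    have "(\<lambda>h. c *\<^sub>C h) ` closure (span ?A) \<subseteq> closure ((\<lambda>h. c *\<^sub>C h) ` span ?A)"
      by (rule closure_bounded_linear_image_subset) (rule bounded_linear_scaleC)
    also have "\<dots> \<subseteq> W" unfolding W_def using cspan by (intro closure_mono) auto
    finally show ?thesis using that by (auto simp: W_def)
  qed
  obtain q :: "'h \<Rightarrow>\<^sub>L 'h" where q: "q \<in> cbounded_ops" "\<And>h. q h \<in> W"
    "\<And>h w. w \<in> W \<Longrightarrow> inner (h - q h) w = 0"
    and eqI: "\<And>h p. p \<in> W \<Longrightarrow> (\<And>w. w \<in> W \<Longrightarrow> inner (h - p) w = 0) \<Longrightarrow> q h = p"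
    using orthogonal_projection_exists[OF cl sW cW] by blast
  have sym: "inner (q h) k = inner h (q k)" for h k
    using q(3)[OF q(2)[of k], of h] q(3)[OF q(2)[of h], of k] inner_commute[of "q h" k]
      inner_commute[of "q h" "q k"]
    by (simp add: inner_diff_left)
  have fixes_range: "q (adj y k) = adj y k" if "y \<in> L" for y k
  proof (rule eqI)
    have "adj y k \<in> span ?A" using that by (auto intro: span_base)
    then show "adj y k \<in> W" using AW by blast
  qed simp
  have y_q: "y (q h) = y h" if y: "y \<in> L" for y h
  proof (rule inner_eq_imp_eq)
    fix k
    have "inner k (y (q h)) = inner (adj y k) (q h)" by (simp add: inner_adj_left[OF LC[OF y]])
    also have "\<dots> = inner (adj y k) h" by (simp add: sym[symmetric] fixes_range[OF y])
    finally show "inner k (y (q h)) = inner k (y h)" by (simp add: inner_adj_left[OF LC[OF y]])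
  qed
  have kernel: "q h = 0" if "\<And>y. y \<in> L \<Longrightarrow> y h = 0" for h
  proof (rule eqI)
    show "0 \<in> W" using sW by (rule subspace_0)
    fix w assume "w \<in> W"
    moreover have "closed {w. inner h w = 0}" by (intro closed_Collect_eq continuous_intros)
    moreover have "span ?A \<subseteq> {w. inner h w = 0}"
      by (rule span_minimal) (use that in \<open>auto simp: subspace_def inner_add_right inner_adj_right[OF LC]\<close>)
    ultimately have "inner h w = 0" unfolding W_def using closure_minimal by blast
    then show "inner (h - 0) w = 0" by simp
  qed
  have "q \<in> M"
  proof (rule von_neumann_algebra_strongly_closed[OF M q(1)])
    fix F :: "'h set" and \<epsilon> :: real
    assume F: "finite F" and \<epsilon>: "0 < \<epsilon>"
    have "\<exists>g\<in>span ?A. dist g (q h) < \<epsilon> / 2" for h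
      using q(2)[of h] half_gt_zero[OF \<epsilon>] unfolding W_def closure_approachable by blast
    then obtain g where g: "\<And>h. g h \<in> span ?A" "\<And>h. dist (g h) (q h) < \<epsilon> / 2" by metis
    obtain S where S: "\<And>h. finite (S h)" "\<And>h. S h \<subseteq> L"
      "\<And>h. g h \<in> span (\<Union>y\<in>S h. range (blinfun_apply (adj y)))"
      using span_finite_support[OF g(1)] by metis
    define J where "J = (\<Union>h\<in>F. S h)"
    have J: "finite J" "J \<subseteq> L" using F S by (auto simp: J_def)
    obtain a where a: "a \<in> M" "\<And>h k. inner (a h) k = (\<Sum>y\<in>J. inner (blinfun_apply y h) (y k))"
      using sum_adj_compose_self[OF M J(1)] J(2) L by blast
    have asym: "inner (a h) k = inner h (a k)" for h k
    proof -
      have "inner (a h) k = inner (a k) h" unfolding a(2) by (intro sum.cong inner_commute refl)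
      also have "\<dots> = inner h (a k)" by (rule inner_commute)
      finally show ?thesis .
    qed
    have apos: "0 \<le> inner (a h) h" for h by (simp add: a(2) sum_nonneg)
    have dom: "(norm (y h))\<^sup>2 \<le> inner (a h) h" if "y \<in> J" for y h
      using member_le_sum[OF that, of "\<lambda>y. inner (blinfun_apply y h) (y h)"] J(1)
      by (simp add: a(2) power2_norm_eq_inner)
    \<comment> \<open>The summand \<open>1\<close> guards against \<open>norm a = 0\<close>.\<close>
    define e where "e = 1 / (norm a + 1)"
    have "0 < norm a + 1" using norm_ge_zero[of a] by linarith
    then have e: "0 < e" "e * norm a \<le> 1" by (simp_all add: e_def pos_divide_le_eq)
    let ?r = "\<lambda>n. richardson e a ^^ n"
    have r_diff: "?r n (h - k) = ?r n h - ?r n k" for n h k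
      using linear_simps(2)[OF bounded_linear_richardson_power] by blast
    have decay: "(\<lambda>n. ?r n v) \<longlonglongrightarrow> 0" if "v \<in> span (\<Union>y\<in>J. range (blinfun_apply (adj y)))" for v
      using that
    proof (induction rule: span_induct_alt)
      case base
      then show ?case using linear_simps(3)[OF bounded_linear_richardson_power, of _ e a] by simp
    next
      case (step c x v)
      then obtain y k where y: "y \<in> J" "x = adj y k" by blast
      then have "(\<lambda>n. ?r n x) \<longlonglongrightarrow> 0"
        using richardson_power_tendsto_0[OF asym e _ dom[OF y(1)]] J(2) LC by blast
      then have "(\<lambda>n. c *\<^sub>R ?r n x + ?r n v) \<longlonglongrightarrow> c *\<^sub>R 0 + 0" using step by (intro tendsto_intros)
      then show ?case
        using linear_simps(1,5)[OF bounded_linear_richardson_power, of _ e a] by simp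
    qed
    have "\<forall>\<^sub>F n in sequentially. \<forall>h\<in>F. norm (?r n (g h)) < \<epsilon> / 2"
    proof (rule eventually_ball_finite[OF F], rule ballI)
      fix h assume "h \<in> F"
      then have "S h \<subseteq> J" by (auto simp: J_def)
      then have "g h \<in> span (\<Union>y\<in>J. range (blinfun_apply (adj y)))"
        using S(3)[of h] span_mono[of "\<Union>y\<in>S h. range (blinfun_apply (adj y))" "\<Union>y\<in>J. range (blinfun_apply (adj y))"]
        by blast
      from decay[OF this] show "\<forall>\<^sub>F n in sequentially. norm (?r n (g h)) < \<epsilon> / 2"
        using \<epsilon> by (auto simp: tendsto_iff dest: spec[of _ "\<epsilon> / 2"])
    qed
    then obtain n where n: "\<And>h. h \<in> F \<Longrightarrow> norm (?r n (g h)) < \<epsilon> / 2"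
      using eventually_happens' sequentially_bot by blast
    obtain t where t: "t \<in> M" "\<And>h. t h = h - ?r n h"
      using one_minus_richardson_power_in_algebra[OF M a(1)] by blast
    have "norm (t h - q h) < \<epsilon>" if h: "h \<in> F" for h
    proof -
      have "a (h - q h) = 0"
      proof (rule inner_eq_imp_eq)
        fix k
        have "inner k (a (h - q h)) = (\<Sum>y\<in>J. inner (blinfun_apply y k) (y (h - q h)))"
          by (simp only: asym[symmetric] a(2))
        also have "\<dots> = 0" using J(2) by (intro sum.neutral) (auto simp: blinfun.diff_right y_q)
        finally show "inner k (a (h - q h)) = inner k 0" by simp
      qed
      then have "?r m (h - q h) = h - q h" for m
        by (induction m) (simp_all add: richardson_def)
      then have "?r n h - ?r n (q h) = h - q h" unfolding r_diff .
      then have "t h - q h = - ?r n (q h)" unfolding t(2) by (simp add: algebra_simps)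
      \<comment> \<open>The first part is small by the choice of \<open>n\<close>, the second because the iteration is a contraction.\<close>
      also have "\<dots> = - (?r n (g h) + ?r n (q h - g h))" by (simp add: r_diff)
      finally have "norm (t h - q h) \<le> norm (?r n (g h)) + norm (?r n (q h - g h))"
        by (simp only: norm_minus_cancel norm_triangle_ineq)
      also have "\<dots> \<le> norm (?r n (g h)) + norm (q h - g h)"
        using norm_richardson_power_le[OF asym apos _ e(2)] e(1) by simp
      also have "\<dots> < \<epsilon> / 2 + \<epsilon> / 2"
        using n[OF h] g(2)[of h] by (simp add: dist_norm norm_minus_commute)
      finally show ?thesis by simp
    qed
    then show "\<exists>a\<in>M. \<forall>h\<in>F. norm (blinfun_apply a h - q h) < \<epsilon>" using t(1) by blast
  qed
  then show thesis using that sym q(2) kernel y_q unfolding W_def by blast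
qed

section \<open>The star order\<close>

lemma adj_self_eq_0:
  assumes "x \<in> cbounded_ops" "blinfun_apply (adj x) (blinfun_apply x h) = 0"
  shows "blinfun_apply x h = 0"
proof -
  have "inner (x h) (x h) = inner h (adj x (x h))" by (simp add: inner_adj_right[OF assms(1)])
  then show ?thesis using assms(2) by simp
qed

lemma adj_compose_transpose:
  assumes C: "a \<in> cbounded_ops" "b \<in> cbounded_ops" "c \<in> cbounded_ops" "d \<in> cbounded_ops"
    and eq: "\<And>h. blinfun_apply a (blinfun_apply (adj b) h) = blinfun_apply c (blinfun_apply (adj d) h)"
  shows "blinfun_apply b (blinfun_apply (adj a) h) = blinfun_apply d (blinfun_apply (adj c) h)"
proof (rule inner_eq_imp_eq)
  fix k
  have "inner k (b (adj a h)) = inner (a (adj b k)) h"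
    by (simp only: inner_adj_left[OF C(2), symmetric] inner_adj_right[OF C(1)])
  also have "\<dots> = inner k (d (adj c h))"
    unfolding eq by (simp only: inner_adj_left[OF C(4), symmetric] inner_adj_right[OF C(3)])
  finally show "inner k (b (adj a h)) = inner k (d (adj c h))" .
qed

lemma star_leI:
  assumes "\<And>h. blinfun_apply (adj x) (blinfun_apply y h) = adj x (x h)"
    and "\<And>h. blinfun_apply y (blinfun_apply (adj x) h) = x (adj x h)"
  shows "x \<preceq>\<^sub>\<star> y"
  unfolding star_le_def using assms by (auto intro!: blinfun_eqI)

text \<open>
  The last two equations are the adjoints of the two defining ones. Oriented like this, the four
  replace \<open>y\<close> by \<open>x\<close> wherever it is multiplied with \<open>x\<close> and exactly one of the two factors is an adjoint.
\<close>

lemma star_leD: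
  assumes xy: "x \<in> cbounded_ops" "y \<in> cbounded_ops" and le: "x \<preceq>\<^sub>\<star> y"
  shows "blinfun_apply (adj x) (blinfun_apply y h) = adj x (x h)"
    and "blinfun_apply y (blinfun_apply (adj x) h) = x (adj x h)"
    and "blinfun_apply (adj y) (blinfun_apply x h) = adj x (x h)"
    and "blinfun_apply x (blinfun_apply (adj y) h) = x (adj x h)"
proof -
  show 1: "adj x (y h) = adj x (x h)" for h
    using arg_cong[OF conjunct1[OF le[unfolded star_le_def]], of "\<lambda>z. blinfun_apply z h"] by simp
  show 2: "y (adj x h) = x (adj x h)" for h
    using arg_cong[OF conjunct2[OF le[unfolded star_le_def]], of "\<lambda>z. blinfun_apply z h"] by simp
  show "x (adj y h) = x (adj x h)"
    by (rule adj_compose_transpose[OF xy(2,1,1,1) 2])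
  have "adj x (adj (adj y) h) = adj x (adj (adj x) h)" for h
    using 1 xy by (simp add: adj_adj)
  then have "adj y (adj (adj x) h) = adj x (adj (adj x) h)"
    by (rule adj_compose_transpose[rotated 4]) (simp_all add: xy adj_in_cbounded_ops)
  then show "adj y (x h) = adj x (x h)" using xy by (simp add: adj_adj)
qed

lemma star_le_refl: "x \<preceq>\<^sub>\<star> x"
  by (simp add: star_le_def)

lemma star_le_antisym:
  assumes "x \<in> cbounded_ops" "y \<in> cbounded_ops" "x \<preceq>\<^sub>\<star> y" "y \<preceq>\<^sub>\<star> x"
  shows "x = y"
proof (rule blinfun_eqI)
  fix h
  \<comment> \<open>The four products in \<open>(x - y)\<^sup>* (x - y)\<close> all coincide, so it vanishes.\<close>
  have "adj x (y h) = adj x (x h)" "adj y (x h) = adj x (x h)" "adj y (x h) = adj y (y h)"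
    using star_leD[OF assms(1,2,3)] star_leD[OF assms(2,1,4)] by auto
  then have "inner (x h - y h) (x h - y h) = 0"
    using inner_adj_right[OF assms(1), of h] inner_adj_right[OF assms(2), of h]
    by (simp add: inner_diff_left inner_diff_right) (metis inner_commute)
  then show "x h = y h" by simp
qed

text \<open>
  If \<open>x \<preceq>\<^sub>\<star> y\<close>, then \<open>y\<close> vanishes only where \<open>x\<close> does, and likewise for the adjoints; these two
  kernel inclusions carry the orthogonality relations between \<open>y\<close> and \<open>z - y\<close> over to \<open>x\<close>.
\<close>

lemma star_le_trans:
  assumes C: "x \<in> cbounded_ops" "y \<in> cbounded_ops" "z \<in> cbounded_ops" and le: "x \<preceq>\<^sub>\<star> y" "y \<preceq>\<^sub>\<star> z"
  shows "x \<preceq>\<^sub>\<star> z"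
proof (rule star_leI)
  note xy = star_leD[OF C(1,2) le(1)] and yz = star_leD[OF C(2,3) le(2)]
  have ker: "x h = 0" if "y h = 0" for h
    using adj_self_eq_0[OF C(1)] xy(1)[of h] that by (simp add: blinfun.zero_right)
  have adj_ker: "adj x h = 0" if "adj y h = 0" for h
    using adj_self_eq_0[OF adj_in_cbounded_ops[OF C(1)]] xy(4)[of h] that C(1)
    by (simp add: blinfun.zero_right adj_adj)
  have "adj x (z h - y h) = 0" for h by (rule adj_ker) (simp add: blinfun.diff_right yz)
  then show "adj x (z h) = adj x (x h)" for h using xy(1)[of h] by (simp add: blinfun.diff_right)
  have "x (adj z h - adj y h) = 0" for h by (rule ker) (simp add: blinfun.diff_right yz)
  then have *: "x (adj z h) = x (adj x h)" for h using xy(4)[of h] by (simp add: blinfun.diff_right)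
  show "z (adj x h) = x (adj x h)" for h
    by (rule adj_compose_transpose[OF C(1,3,1,1) *])
qed

lemma star_le_adj:
  assumes C: "x \<in> cbounded_ops" "y \<in> cbounded_ops" and le: "x \<preceq>\<^sub>\<star> y"
  shows "adj x \<preceq>\<^sub>\<star> adj y"
  by (rule star_leI) (use star_leD[OF C le] C in \<open>simp_all add: adj_adj\<close>)

section \<open>Bounded suprema in the star order\<close>

text \<open>
  Every upper bound \<open>w\<close> of \<open>L\<close> agrees with \<open>u\<close> on the range of \<open>q\<close>, the join of the right
  supports: \<open>y w\<^sup>* = y y\<^sup>* = y u\<^sup>*\<close> for \<open>y \<in> L\<close> gives \<open>q (w - u)\<^sup>* = 0\<close>. The same kernel
  argument shows that \<open>q\<close> commutes with \<open>u\<^sup>* u\<close>, so \<open>u q\<close> is below every upper bound.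
\<close>

lemma star_sup_compression:
  fixes M :: "('h::chilbert_space \<Rightarrow>\<^sub>L 'h) set"
  assumes M: "von_neumann_algebra M" and L: "L \<subseteq> M" and u: "u \<in> M" "\<And>y. y \<in> L \<Longrightarrow> y \<preceq>\<^sub>\<star> u"
  obtains q where "q \<in> M" "\<And>h k. inner (q h) k = inner h (q k)"
    "\<And>h. blinfun_apply q h \<in> closure (span (\<Union>y\<in>L. range (blinfun_apply (adj y))))"
    "\<And>y h. y \<in> L \<Longrightarrow> blinfun_apply y (q h) = y h"
    "is_sup_in M (\<preceq>\<^sub>\<star>) L (u o\<^sub>L q)"
proof -
  obtain q where q: "q \<in> M" "\<And>h k. inner (q h) k = inner h (q k)"
    "\<And>h. blinfun_apply q h \<in> closure (span (\<Union>y\<in>L. range (blinfun_apply (adj y))))"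
    "\<And>h. (\<And>y. y \<in> L \<Longrightarrow> blinfun_apply y h = 0) \<Longrightarrow> q h = 0"
    "\<And>y h. y \<in> L \<Longrightarrow> blinfun_apply y (q h) = y h"
    using support_projection[OF M L] by blast
  have C: "x \<in> cbounded_ops" if "x \<in> M" for x using that von_neumann_algebraD(1)[OF M] by blast
  have LC: "y \<in> cbounded_ops" if "y \<in> L" for y using that L C by blast
  note uC = C[OF u(1)]
  have q_eqI: "q g = q h" if "\<And>y. y \<in> L \<Longrightarrow> y g = y h" for g h
    using q(4)[of "g - h"] that by (simp add: blinfun.diff_right)
  have qq: "q (q h) = q h" for h by (rule q_eqI) (rule q(5))
  have q_adj: "q (adj y k) = adj y k" if "y \<in> L" for y k
    by (rule inner_eq_imp_eq)
      (simp add: q(2)[symmetric] inner_adj_right[OF LC[OF that]] q(5)[OF that])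
  define s where "s = u o\<^sub>L q"
  have sM: "s \<in> M" unfolding s_def by (intro von_neumann_algebraD[OF M] u q)
  have adj_s: "adj s = q o\<^sub>L adj u"
    by (rule adj_eqI_real[OF C[OF sM]]) (simp add: s_def q(2)[symmetric] inner_adj_right[OF uC])
  have upper: "y \<preceq>\<^sub>\<star> s" if y: "y \<in> L" for y
  proof (rule star_leI)
    note yu = star_leD[OF LC[OF y] uC u(2)[OF y]]
    show "adj y (s h) = adj y (y h)" "s (adj y h) = y (adj y h)" for h
      using yu q_adj[OF y] q(5)[OF y] by (simp_all add: s_def)
  qed
  have least: "s \<preceq>\<^sub>\<star> w" if w: "w \<in> M" "\<And>y. y \<in> L \<Longrightarrow> y \<preceq>\<^sub>\<star> w" for w
  proof -
    note wC = C[OF w(1)]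
    note yu = star_leD[OF LC uC u(2)] and yw = star_leD[OF LC wC w(2)]
    have "q (adj u k) = q (adj w k)" for k by (rule q_eqI) (simp add: yu yw)
    then have "inner k (u (q h)) = inner k (w (q h))" for h k
      by (simp only: inner_adj_left[OF uC, symmetric] inner_adj_left[OF wC, symmetric] q(2)[symmetric])
    then have uw: "u (q h) = w (q h)" for h by (rule inner_eq_imp_eq)
    have cross: "q (adj u (u h)) = q (adj u (w h))" for h
      by (rule q_eqI) (simp add: yu yw)
    have commute: "q (adj u (u (q h))) = q (adj u (u h))" for h
      by (rule q_eqI) (simp add: yu q(5))
    show ?thesis
    proof (rule star_leI)
      show "adj s (w h) = adj s (s h)" for h
        by (simp add: adj_s[unfolded s_def] s_def commute cross[symmetric])
      show "w (adj s h) = s (adj s h)" for h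
        by (simp add: adj_s[unfolded s_def] s_def uw qq)
    qed
  qed
  have "is_sup_in M (\<preceq>\<^sub>\<star>) L s"
    unfolding is_sup_in_def using sM upper least by blast
  then show thesis using that q unfolding s_def by blast
qed

lemma is_sup_in_star_unique:
  assumes M: "von_neumann_algebra M" and "is_sup_in M (\<preceq>\<^sub>\<star>) L s" "is_sup_in M (\<preceq>\<^sub>\<star>) L t"
  shows "s = t"
proof (rule star_le_antisym)
  show "s \<in> cbounded_ops" "t \<in> cbounded_ops"
    using assms(2,3) von_neumann_algebraD(1)[OF M] unfolding is_sup_in_def by blast+
  show "s \<preceq>\<^sub>\<star> t" "t \<preceq>\<^sub>\<star> s" using assms(2,3) unfolding is_sup_in_def by blast+
qed

section \<open>The four subsets are closed under suprema and infima\<close>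

lemma self_adjointsD: "x \<in> self_adjoints M \<Longrightarrow> x \<in> M" "x \<in> self_adjoints M \<Longrightarrow> adj x = x"
  by (simp_all add: self_adjoints_def)

text \<open>
  The adjoint is an order automorphism that fixes every element of \<open>S\<close>, hence it fixes the
  supremum and the infimum of \<open>S\<close>.
\<close>

lemma self_adjoints_sup_closed:
  assumes M: "von_neumann_algebra M" and S: "S \<subseteq> self_adjoints M" and s: "is_sup_in M (\<preceq>\<^sub>\<star>) S s"
  shows "s \<in> self_adjoints M"
proof -
  have sM: "s \<in> M" using s by (simp add: is_sup_in_def)
  have C: "x \<in> cbounded_ops" if "x \<in> M" for x using that von_neumann_algebraD(1)[OF M] by blast
  have aM: "adj s \<in> M" by (rule von_neumann_algebraD(7)[OF M sM])
  have "x \<preceq>\<^sub>\<star> adj s" if "x \<in> S" for x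
    using star_le_adj[of x s] that S s C sM self_adjointsD[of x M] unfolding is_sup_in_def by auto
  then have le: "s \<preceq>\<^sub>\<star> adj s" using s aM unfolding is_sup_in_def by blast
  have "adj s \<preceq>\<^sub>\<star> s" using star_le_adj[OF C[OF sM] C[OF aM] le] by (simp add: adj_adj[OF C[OF sM]])
  then have "adj s = s" using star_le_antisym[OF C[OF aM] C[OF sM]] le by blast
  with sM show ?thesis by (simp add: self_adjoints_def)
qed

lemma self_adjoints_inf_closed:
  assumes M: "von_neumann_algebra M" and S: "S \<subseteq> self_adjoints M" and s: "is_inf_in M (\<preceq>\<^sub>\<star>) S s"
  shows "s \<in> self_adjoints M"
proof -
  have sM: "s \<in> M" using s by (simp add: is_sup_in_def is_inf_in_def)
  have C: "x \<in> cbounded_ops" if "x \<in> M" for x using that von_neumann_algebraD(1)[OF M] by blast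
  have aM: "adj s \<in> M" by (rule von_neumann_algebraD(7)[OF M sM])
  have "adj s \<preceq>\<^sub>\<star> x" if "x \<in> S" for x
    using star_le_adj[of s x] that S s C sM self_adjointsD[of x M] unfolding is_sup_in_def is_inf_in_def by auto
  then have le: "adj s \<preceq>\<^sub>\<star> s" using s aM unfolding is_sup_in_def is_inf_in_def by blast
  have "s \<preceq>\<^sub>\<star> adj s" using star_le_adj[OF C[OF aM] C[OF sM] le] by (simp add: adj_adj[OF C[OF sM]])
  then have "adj s = s" using star_le_antisym[OF C[OF aM] C[OF sM]] le by blast
  with sM show ?thesis by (simp add: self_adjoints_def)
qed

lemma inner_self_adjoint:
  assumes "x \<in> cbounded_ops" "adj x = x"
  shows "inner (blinfun_apply x h) k = inner h (x k)"
  using inner_adj_right[OF assms(1), of h k] assms(2) by simp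

lemma scaleC_simps:
  fixes x :: "'h::complex_inner"
  shows "1 *\<^sub>C x = x" "(- c) *\<^sub>C x = - (c *\<^sub>C x)" "c *\<^sub>C (- x) = - (c *\<^sub>C x)"
proof -
  show *: "1 *\<^sub>C x = x" for x :: 'h using scaleR_eq_scaleC[of 1 x] by simp
  have "(-1) *\<^sub>C x = - x" for x :: 'h using scaleR_eq_scaleC[of "-1" x] by simp
  then show "(- c) *\<^sub>C x = - (c *\<^sub>C x)" "c *\<^sub>C (- x) = - (c *\<^sub>C x)"
    using scaleC_scaleC[of "-1" c x] scaleC_scaleC[of c "-1" x] by simp_all
qed

text \<open>
  Positivity of the complex quadratic form contains self-adjointness: the real bilinear form
  \<open>inner (\<i> *\<^sub>C x h) k\<close> vanishes on the diagonal, hence is antisymmetric, and replacing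
  \<open>h\<close> by \<open>\<i> *\<^sub>C h\<close> turns antisymmetry into symmetry of \<open>inner (x h) k\<close>.
\<close>

lemma positives_iff:
  assumes M: "von_neumann_algebra M"
  shows "x \<in> positives M \<longleftrightarrow> x \<in> self_adjoints M \<and> (\<forall>h. 0 \<le> inner (blinfun_apply x h) h)"
proof (cases "x \<in> M")
  case True
  then have C: "x \<in> cbounded_ops" using von_neumann_algebraD(1)[OF M] by blast
  have cinner: "cinner (x h) h \<in> \<real>\<^sub>\<ge>\<^sub>0 \<longleftrightarrow> 0 \<le> inner (x h) h \<and> inner (\<i> *\<^sub>C x h) h = 0" for h
    by (auto simp: cinner_eq_inner complex_nonneg_Reals_iff)
  have adj: "adj x = x" if diag: "\<And>h. inner (\<i> *\<^sub>C x h) h = 0"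
  proof (rule adj_eqI_real[OF C])
    have anti: "inner (\<i> *\<^sub>C x h) k = - inner (\<i> *\<^sub>C x k) h" for h k
      using diag[of "h + k"] diag[of h] diag[of k]
      by (simp add: blinfun.add_right scaleC_add_right inner_add_left inner_add_right)
    fix h k
    have "inner (x h) k = - inner (\<i> *\<^sub>C x (\<i> *\<^sub>C h)) k"
      by (simp add: cbounded_opsD[OF C] scaleC_scaleC scaleC_simps)
    also have "\<dots> = inner (\<i> *\<^sub>C x k) (\<i> *\<^sub>C h)" using anti[of "\<i> *\<^sub>C h" k] by simp
    also have "\<dots> = inner (x k) h" by (simp add: inner_scaleC_right scaleC_scaleC scaleC_simps)
    finally show "inner (x h) k = inner h (x k)" by (simp add: inner_commute)
  qed
  have "inner (\<i> *\<^sub>C x h) h = 0" if "adj x = x" for h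
  proof -
    have "inner (\<i> *\<^sub>C x h) h = inner (\<i> *\<^sub>C h) (x h)"
      by (simp add: cbounded_opsD[OF C, symmetric] inner_self_adjoint[OF C that])
    also have "\<dots> = inner (x h) (\<i> *\<^sub>C h)" by (rule inner_commute)
    also have "\<dots> = - inner (\<i> *\<^sub>C x h) h" by (simp add: inner_scaleC_right scaleC_simps)
    finally show ?thesis by simp
  qed
  with adj True show ?thesis unfolding positives_def self_adjoints_def mem_Collect_eq cinner by blast
qed (simp add: positives_def self_adjoints_def)

lemma positives_subset_self_adjoints:
  assumes "von_neumann_algebra M"
  shows "positives M \<subseteq> self_adjoints M"
  by (simp add: subset_iff positives_iff[OF assms])

text \<open>
  With \<open>q\<close> the support of \<open>y\<close>, one has \<open>y = x q\<close> and \<open>y = y q\<close>, so by self-adjointness \<open>y = q x q\<close>.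
\<close>

lemma self_adjoint_below_positive:
  assumes M: "von_neumann_algebra M" and x: "x \<in> positives M" and y: "y \<in> self_adjoints M" and le: "y \<preceq>\<^sub>\<star> x"
  shows "y \<in> positives M"
proof -
  have yM: "y \<in> M" "adj y = y" "x \<in> M" using x y by (simp_all add: self_adjoints_def positives_def)
  have yC: "y \<in> cbounded_ops" using yM von_neumann_algebraD(1)[OF M] by blast
  have "{y} \<subseteq> M" "\<And>z. z \<in> {y} \<Longrightarrow> z \<preceq>\<^sub>\<star> x" using yM(1) le by auto
  then obtain q where q: "\<And>h. y (blinfun_apply q h) = y h" "is_sup_in M (\<preceq>\<^sub>\<star>) {y} (x o\<^sub>L q)"
    using star_sup_compression[OF M _ yM(3)] by (metis insertI1)
  have "is_sup_in M (\<preceq>\<^sub>\<star>) {y} y" using yM by (auto simp: is_sup_in_def star_le_refl)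
  then have yxq: "y = x o\<^sub>L q" using is_sup_in_star_unique[OF M _ q(2)] by blast
  have "0 \<le> inner (y h) h" for h
  proof -
    have "inner (y h) h = inner (q h) (y h)"
      using inner_self_adjoint[OF yC yM(2), of "q h" h] by (simp add: q(1))
    also have "\<dots> = inner (x (q h)) (q h)" using yxq by (metis blinfun_apply_blinfun_compose inner_commute)
    also have "\<dots> \<ge> 0" using x by (simp add: positives_iff[OF M])
    finally show ?thesis .
  qed
  with y show ?thesis by (simp add: positives_iff[OF M])
qed

lemma positives_inf_closed:
  assumes M: "von_neumann_algebra M" and S: "S \<subseteq> positives M" "S \<noteq> {}" and s: "is_inf_in M (\<preceq>\<^sub>\<star>) S s"
  shows "s \<in> positives M"
proof -
  have "S \<subseteq> self_adjoints M" using S(1) positives_subset_self_adjoints[OF M] by (rule order_trans)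
  from self_adjoints_inf_closed[OF M this s] have "s \<in> self_adjoints M" .
  moreover obtain x where "x \<in> S" using S(2) by blast
  moreover from this have "s \<preceq>\<^sub>\<star> x" using s by (simp add: is_inf_in_def is_sup_in_def)
  ultimately show ?thesis using self_adjoint_below_positive[OF M] S(1) by blast
qed

text \<open>
  The vectors with bounded Richardson orbit form a subspace on which \<open>s\<close> has a nonnegative
  quadratic form (it is the spectral subspace of \<open>s\<close> for \<open>[0, \<infinity>)\<close>). The subspace contains the range of
  every positive \<open>y\<close> below \<open>s\<close>, where the iterations for \<open>s\<close> and \<open>y\<close> agree, so by
  continuity the form is nonnegative on the range of the join \<open>q\<close> of the supports;
  and \<open>s = s q\<close> because \<open>s\<close> is the supremum.
\<close>

lemma positives_sup_closed:
  assumes M: "von_neumann_algebra M" and S: "S \<subseteq> positives M" and s: "is_sup_in M (\<preceq>\<^sub>\<star>) S s"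
  shows "s \<in> positives M"
proof -
  have Ssa: "S \<subseteq> self_adjoints M" using S positives_subset_self_adjoints[OF M] by (rule order_trans)
  have ssa: "s \<in> self_adjoints M" by (rule self_adjoints_sup_closed[OF M Ssa s])
  have SM: "S \<subseteq> M" and sM: "s \<in> M" and adj_s: "adj s = s" and up: "\<And>y. y \<in> S \<Longrightarrow> y \<preceq>\<^sub>\<star> s"
    using Ssa ssa s by (auto simp: self_adjoints_def is_sup_in_def)
  have C: "x \<in> cbounded_ops" if "x \<in> M" for x using that von_neumann_algebraD(1)[OF M] by blast
  note sym = inner_self_adjoint[OF C[OF sM] adj_s]
  define e where "e = 1 / (norm s + 1)"
  have "0 < norm s + 1" using norm_ge_zero[of s] by linarith
  then have e: "0 < e" "e * norm s \<le> 1" by (simp_all add: e_def pos_divide_le_eq)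
  let ?r = "\<lambda>n. richardson e s ^^ n"
  let ?A = "\<Union>y\<in>S. range (blinfun_apply (adj y))"
  define V where "V = {h. \<exists>B. \<forall>n. norm (?r n h) \<le> B}"
  have "subspace V"
    unfolding subspace_def
  proof (intro conjI ballI allI)
    show "0 \<in> V"
      using linear_simps(3)[OF bounded_linear_richardson_power, of _ e s] by (auto simp: V_def)
    fix h k assume "h \<in> V" "k \<in> V"
    then obtain B D where "\<And>n. norm (?r n h) \<le> B" "\<And>n. norm (?r n k) \<le> D" by (auto simp: V_def)
    then have "norm (?r n (h + k)) \<le> B + D" for n
      using norm_triangle_mono linear_simps(1)[OF bounded_linear_richardson_power] by metis
    then show "h + k \<in> V" by (auto simp: V_def)
  next
    fix c h assume "h \<in> V"
    then obtain B where "\<And>n. norm (?r n h) \<le> B" by (auto simp: V_def)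
    then have "norm (?r n (c *\<^sub>R h)) \<le> \<bar>c\<bar> * B" for n
      using linear_simps(5)[OF bounded_linear_richardson_power, of n e s c h] by (simp add: mult_left_mono)
    then show "c *\<^sub>R h \<in> V" by (auto simp: V_def)
  qed
  moreover have "?A \<subseteq> V"
  proof clarify
    fix y k assume y: "y \<in> S"
    then have yM: "y \<in> M" and adj_y: "adj y = y" and ypos: "\<And>h. 0 \<le> inner (y h) h"
      using Ssa S positives_iff[OF M] by (auto simp: self_adjoints_def)
    note ysym = inner_self_adjoint[OF C[OF yM] adj_y]
    note ys = star_leD[OF C[OF yM] C[OF sM] up[OF y]]
    have "norm (y h) \<le> norm s * norm h" for h
    proof -
      have "norm (y h) * norm (y h) = inner (y (y h)) h"
        by (simp add: ysym power2_norm_eq_inner[symmetric] power2_eq_square)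
      also have "\<dots> = inner (y (s h)) h" using ys(1)[of h] by (simp add: adj_y)
      also have "\<dots> = inner (s h) (y h)" by (rule ysym)
      also have "\<dots> \<le> norm (s h) * norm (y h)" by (rule norm_cauchy_schwarz)
      also have "\<dots> \<le> (norm s * norm h) * norm (y h)" by (intro mult_right_mono norm_blinfun) simp
      finally show ?thesis by (cases "norm (y h) = 0") auto
    qed
    then have "norm y \<le> norm s" by (intro norm_blinfun_bound) auto
    then have ey: "e * norm y \<le> 1" using e by (meson mult_left_mono less_imp_le order_trans)
    have "?r n (y k) = y ((richardson e y ^^ n) k)" for n
      using ys(2) by (induction n) (simp_all add: richardson_def adj_y blinfun.diff_right blinfun.scaleR_right)
    moreover have "(richardson e y ^^ n) (y k) = y ((richardson e y ^^ n) k)" for n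
      by (induction n) (simp_all add: richardson_def blinfun.diff_right blinfun.scaleR_right)
    ultimately have "norm (?r n (y k)) \<le> norm (y k)" for n
      using norm_richardson_power_le[OF ysym ypos less_imp_le[OF e(1)] ey, of n "y k"] by simp
    then show "adj y k \<in> V" by (auto simp: V_def adj_y)
  qed
  ultimately have "span ?A \<subseteq> V" by (intro span_minimal)
  moreover have "0 \<le> inner (s h) h" if "h \<in> V" for h
    using that bounded_richardson_orbit_imp_nonneg[OF sym e(1)] by (auto simp: V_def)
  ultimately have "span ?A \<subseteq> {h. 0 \<le> inner (s h) h}" by blast
  moreover have "closed {h. 0 \<le> inner (s h) h}"
    by (intro closed_Collect_le continuous_intros)
  ultimately have cl: "closure (span ?A) \<subseteq> {h. 0 \<le> inner (s h) h}" by (rule closure_minimal)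
  obtain q where "q \<in> M" "\<And>h k. inner (q h) k = inner h (q k)"
    and q: "\<And>h. blinfun_apply q h \<in> closure (span ?A)"
      "\<And>y h. y \<in> S \<Longrightarrow> blinfun_apply y (q h) = y h" "is_sup_in M (\<preceq>\<^sub>\<star>) S (s o\<^sub>L q)"
    using star_sup_compression[OF M SM sM up] by blast
  have "s o\<^sub>L q = s" by (rule is_sup_in_star_unique[OF M q(3) s])
  then have sq: "s (q h) = s h" for h by (metis blinfun_apply_blinfun_compose)
  have "0 \<le> inner (s h) h" for h
  proof -
    have "inner (s h) h = inner (q h) (s h)" using sym[of "q h" h] by (simp add: sq)
    also have "\<dots> = inner (s (q h)) (q h)" by (simp add: sq inner_commute)
    finally show ?thesis using cl q(1)[of h] by auto
  qed
  with ssa show ?thesis by (simp add: positives_iff[OF M])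
qed

text \<open>
  \<open>(b\<^sup>2 - b)\<^sup>2\<close> expands to \<open>b (b\<^sup>3 - b\<^sup>2) - (b\<^sup>3 - b\<^sup>2) = 0\<close>, and a self-adjoint
  operator with square zero vanishes.
\<close>

lemma self_adjoint_idempotentI:
  assumes sym: "\<And>h k. inner (blinfun_apply b h) k = inner h (b k)" and cube: "\<And>h. b (b (b h)) = b (b h)"
  shows "blinfun_apply b (b h) = b h"
proof -
  have "inner (b (b h) - b h) (b (b h) - b h) = inner h (b (b (b (b h) - b h)) - b (b (b h) - b h))"
    by (simp only: inner_diff_left inner_diff_right blinfun.diff_right sym)
  also have "\<dots> = 0" by (simp add: blinfun.diff_right cube)
  finally show ?thesis by simp
qed

lemma partial_isometries_iff:
  assumes M: "von_neumann_algebra M"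
  shows "v \<in> partial_isometries M \<longleftrightarrow>
    v \<in> M \<and> (\<forall>h. adj v (blinfun_apply v (adj v (v h))) = blinfun_apply (adj v) (v h))"
proof (cases "v \<in> M")
  case True
  then have C: "v \<in> cbounded_ops" using von_neumann_algebraD(1)[OF M] by blast
  have vv: "adj v o\<^sub>L v \<in> M" using True by (intro von_neumann_algebraD[OF M])
  then have "adj (adj v o\<^sub>L v) = adj v o\<^sub>L v"
    using von_neumann_algebraD(1)[OF M] C
    by (intro adj_eqI_real) (auto simp: inner_adj_left inner_adj_right)
  then show ?thesis using True vv
    by (simp add: partial_isometries_def projections_def blinfun_apply_inject[symmetric] fun_eq_iff)
qed (simp add: partial_isometries_def)

text \<open>
  For \<open>b = y\<^sup>* y\<close> and the projection \<open>p = x\<^sup>* x\<close>, the star order gives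
  \<open>b p = b\<^sup>2\<close>; multiplying by \<open>p\<close> once more gives \<open>b\<^sup>3 = b\<^sup>2\<close>, so \<open>b\<close> is idempotent.
\<close>

lemma below_partial_isometry:
  assumes M: "von_neumann_algebra M" and x: "x \<in> partial_isometries M" and y: "y \<in> M" and le: "y \<preceq>\<^sub>\<star> x"
  shows "y \<in> partial_isometries M"
proof -
  have xM: "x \<in> M" and iso: "adj x (x (adj x (x h))) = adj x (x h)" for h
    using x partial_isometries_iff[OF M] by auto
  have C: "x \<in> cbounded_ops" "y \<in> cbounded_ops" using xM y von_neumann_algebraD(1)[OF M] by blast+
  note yx = star_leD[OF C(2,1) le]
  let ?b = "adj y o\<^sub>L y"
  have b_iso: "?b (adj x (x h)) = ?b (?b h)" for h by (simp add: yx)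
  have "?b (?b h) = ?b h" for h
  proof (rule self_adjoint_idempotentI)
    show "inner (?b h) k = inner h (?b k)" for h k by (simp add: inner_adj_left[OF C(2)] inner_adj_right[OF C(2)])
    show "?b (?b (?b h)) = ?b (?b h)" for h
      using b_iso[of "adj x (x h)"] b_iso[of h] by (simp only: iso)
  qed
  then show ?thesis using y by (simp add: partial_isometries_iff[OF M])
qed

lemma partial_isometries_inf_closed:
  assumes M: "von_neumann_algebra M" and S: "S \<subseteq> partial_isometries M" "S \<noteq> {}" and s: "is_inf_in M (\<preceq>\<^sub>\<star>) S s"
  shows "s \<in> partial_isometries M"
proof -
  obtain x where "x \<in> S" using S(2) by blast
  with s S(1) show ?thesis using below_partial_isometry[OF M, of x s] unfolding is_inf_in_def is_sup_in_def by blast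
qed

text \<open>
  Partial isometries below \<open>s\<close> also lie below \<open>s s\<^sup>* s\<close>, an element of the algebra;
  their supremum \<open>s\<close> therefore satisfies \<open>s \<preceq>\<^sub>\<star> s s\<^sup>* s\<close>, which makes \<open>s\<^sup>* s\<close> idempotent.
\<close>

lemma partial_isometries_sup_closed:
  assumes M: "von_neumann_algebra M" and S: "S \<subseteq> partial_isometries M" and s: "is_sup_in M (\<preceq>\<^sub>\<star>) S s"
  shows "s \<in> partial_isometries M"
proof -
  have C: "x \<in> cbounded_ops" if "x \<in> M" for x using that von_neumann_algebraD(1)[OF M] by blast
  have sM: "s \<in> M" using s by (simp add: is_sup_in_def)
  let ?t = "s o\<^sub>L (adj s o\<^sub>L s)"
  have tM: "?t \<in> M" by (intro von_neumann_algebraD[OF M] sM)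
  have "x \<preceq>\<^sub>\<star> ?t" if "x \<in> S" for x
  proof -
    have xM: "x \<in> M" and iso: "\<And>h. adj x (x (adj x (x h))) = adj x (x h)"
      using that S partial_isometries_iff[OF M] by auto
    have "x (adj x (x h)) = x h" for h
    proof -
      have "x (x' - h) = 0" if "x' = adj x (x h)" for x'
        by (rule adj_self_eq_0[OF C[OF xM]]) (simp add: that blinfun.diff_right iso)
      then show ?thesis by (simp add: blinfun.diff_right)
    qed
    moreover have "x \<preceq>\<^sub>\<star> s" using s that by (simp add: is_sup_in_def)
    note xs = star_leD[OF C[OF xM] C[OF sM] this]
    ultimately show ?thesis using iso by (intro star_leI) (simp_all add: xs)
  qed
  then have le: "s \<preceq>\<^sub>\<star> ?t" using s tM unfolding is_sup_in_def by blast
  from star_leD(1)[OF C[OF sM] C[OF tM] le] show ?thesis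
    using sM by (simp add: partial_isometries_iff[OF M])
qed

lemma projections_iff: "p \<in> projections M \<longleftrightarrow> p \<in> self_adjoints M \<and> (\<forall>h. blinfun_apply p (p h) = p h)"
  by (simp add: projections_def self_adjoints_def blinfun_apply_inject[of "p o\<^sub>L p" p, symmetric] fun_eq_iff)

text \<open>
  Since \<open>y\<^sup>* y = y\<^sup>* p\<close> vanishes on the kernel of \<open>p\<close>, so does \<open>y\<close>. Hence \<open>y = y p = y y\<^sup>*\<close> is
  self-adjoint and idempotent.
\<close>

lemma below_projection:
  assumes M: "von_neumann_algebra M" and p: "p \<in> projections M" and y: "y \<in> M" and le: "y \<preceq>\<^sub>\<star> p"
  shows "y \<in> projections M"
proof -
  have pM: "p \<in> M" and adj_p: "adj p = p" and pp: "\<And>h. p (p h) = p h"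
    using p by (auto simp: projections_iff self_adjoints_def)
  have C: "p \<in> cbounded_ops" "y \<in> cbounded_ops" using pM y von_neumann_algebraD(1)[OF M] by blast+
  note yp = star_leD[OF C(2,1) le, unfolded adj_p]
  have "y (h - p h) = 0" for h
    by (rule adj_self_eq_0[OF C(2)]) (simp add: yp(1)[symmetric] blinfun.diff_right pp)
  then have yy: "y (adj y h) = y h" for h using yp(4)[of h] by (simp add: blinfun.diff_right)
  have "adj y = y"
  proof (rule adj_eqI_real[OF C(2)])
    fix h k
    have "inner (y h) k = inner (y (adj y h)) k" by (simp add: yy)
    also have "\<dots> = inner h (y (adj y k))"
      by (simp add: inner_adj_right[OF C(2), symmetric] inner_adj_left[OF C(2), symmetric])
    finally show "inner (y h) k = inner h (y k)" by (simp add: yy)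
  qed
  with yy y show ?thesis by (simp add: projections_iff self_adjoints_def)
qed

lemma projections_inf_closed:
  assumes M: "von_neumann_algebra M" and S: "S \<subseteq> projections M" "S \<noteq> {}" and s: "is_inf_in M (\<preceq>\<^sub>\<star>) S s"
  shows "s \<in> projections M"
proof -
  obtain x where "x \<in> S" using S(2) by blast
  with s S(1) show ?thesis using below_projection[OF M, of x s] unfolding is_inf_in_def is_sup_in_def by blast
qed

text \<open>
  Projections below \<open>s\<close> also lie below \<open>s s\<close>, so their supremum satisfies \<open>s \<preceq>\<^sub>\<star> s s\<close>. For
  self-adjoint \<open>s\<close> this says \<open>s\<^sup>3 = s\<^sup>2\<close>, hence \<open>(s\<^sup>2 - s)\<^sup>2 = 0\<close>.
\<close>

lemma projections_sup_closed:
  assumes M: "von_neumann_algebra M" and S: "S \<subseteq> projections M" and s: "is_sup_in M (\<preceq>\<^sub>\<star>) S s"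
  shows "s \<in> projections M"
proof -
  have C: "x \<in> cbounded_ops" if "x \<in> M" for x using that von_neumann_algebraD(1)[OF M] by blast
  have "S \<subseteq> self_adjoints M" using S by (auto simp: projections_iff)
  from self_adjoints_sup_closed[OF M this s] have ssa: "s \<in> self_adjoints M" .
  then have sM: "s \<in> M" and adj_s: "adj s = s" by (simp_all add: self_adjoints_def)
  have tM: "s o\<^sub>L s \<in> M" by (intro von_neumann_algebraD[OF M] sM)
  have "x \<preceq>\<^sub>\<star> s o\<^sub>L s" if "x \<in> S" for x
  proof -
    have x: "x \<in> M" "adj x = x" "\<And>h. x (x h) = x h"
      using that S by (auto simp: projections_iff self_adjoints_def)
    have "x \<preceq>\<^sub>\<star> s" using s that by (simp add: is_sup_in_def)
    note xs = star_leD[OF C[OF x(1)] C[OF sM] this, unfolded x(2) adj_s]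
    show ?thesis by (rule star_leI) (simp_all add: x xs)
  qed
  then have le: "s \<preceq>\<^sub>\<star> s o\<^sub>L s" using s tM unfolding is_sup_in_def by blast
  from star_leD(1)[OF C[OF sM] C[OF tM] le] have "s (s (s h)) = s (s h)" for h by (simp add: adj_s)
  with self_adjoint_idempotentI[OF inner_self_adjoint[OF C[OF sM] adj_s]] have "s (s h) = s h" for h .
  with ssa show ?thesis by (simp add: projections_iff)
qed

section \<open>Relative order topologies\<close>

text \<open>
  The supremum in \<open>Y\<close> bounds \<open>S\<close> in \<open>X\<close>, so \<open>S\<close> has a supremum in \<open>X\<close>; as that lies in \<open>Y\<close>,
  the two coincide. Applied to the reversed order, this also treats infima.
\<close>

lemma is_sup_in_superset:
  assumes antisym: "\<And>x y. x \<in> X \<Longrightarrow> y \<in> X \<Longrightarrow> le x y \<Longrightarrow> le y x \<Longrightarrow> x = y"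
    and complete: "\<And>u. u \<in> X \<Longrightarrow> (\<And>x. x \<in> S \<Longrightarrow> le x u) \<Longrightarrow> \<exists>s. is_sup_in X le S s"
    and Y: "Y \<subseteq> X" "\<And>s. is_sup_in X le S s \<Longrightarrow> s \<in> Y"
    and l: "is_sup_in Y le S l"
  shows "is_sup_in X le S l"
proof -
  have lY: "l \<in> Y" "\<And>x. x \<in> S \<Longrightarrow> le x l" using l by (auto simp: is_sup_in_def)
  then obtain s where s: "is_sup_in X le S s" using complete[of l] Y(1) by blast
  then have "s \<in> Y" using Y(2) by blast
  then have "le l s" "le s l" using s l Y(1) unfolding is_sup_in_def by blast+
  then have "l = s" using antisym lY Y(1) \<open>s \<in> Y\<close> by blast
  with s show ?thesis by simp
qed

text \<open>
  The two halves \<open>restrict\<close> and \<open>extend\<close> of the proof show that the traces on \<open>Y\<close> of order closed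
  subsets of \<open>X\<close> are exactly the order closed subsets of \<open>Y\<close>.
\<close>

lemma subtopology_poset_order_topology:
  fixes X Y :: "'a set"
  assumes antisym: "\<And>x y. x \<in> X \<Longrightarrow> y \<in> X \<Longrightarrow> le x y \<Longrightarrow> le y x \<Longrightarrow> x = y"
    and trans: "transp_on X le"
    and complete: "\<And>S u. S \<subseteq> X \<Longrightarrow> S \<noteq> {} \<Longrightarrow> u \<in> X \<Longrightarrow> (\<And>x. x \<in> S \<Longrightarrow> le x u) \<Longrightarrow> \<exists>s. is_sup_in X le S s"
    and Y: "Y \<subseteq> X"
    and sup_Y: "\<And>S s. S \<subseteq> Y \<Longrightarrow> S \<noteq> {} \<Longrightarrow> is_sup_in X le S s \<Longrightarrow> s \<in> Y"
    and inf_Y: "\<And>S s. S \<subseteq> Y \<Longrightarrow> S \<noteq> {} \<Longrightarrow> is_inf_in X le S s \<Longrightarrow> s \<in> Y"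
  shows "subtopology (poset_order_topology X le) Y = poset_order_topology Y le"
proof -
  have trans': "le x z" if "le x y" "le y z" "x \<in> X" "y \<in> X" "z \<in> X" for x y z
    using that trans unfolding transp_on_def by blast
  have trans_Y: "transp_on Y le" using trans Y by (rule transp_on_subset)
  \<comment> \<open>An infimum is the supremum of the lower bounds.\<close>
  have inf_exists: "\<exists>s. is_inf_in X le S s" if S: "S \<subseteq> X" "S \<noteq> {}" and u: "u \<in> X" "\<And>x. x \<in> S \<Longrightarrow> le u x" for S u
  proof -
    let ?B = "{b \<in> X. \<forall>x\<in>S. le b x}"
    obtain x where x: "x \<in> S" using S(2) by blast
    have "u \<in> ?B" using u by blast
    then obtain s where s: "is_sup_in X le ?B s"
      using complete[of ?B x] x S(1) by auto
    have "is_inf_in X le S s"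
      unfolding is_inf_in_def is_sup_in_def
    proof (intro conjI ballI impI)
      show "s \<in> X" using s by (simp add: is_sup_in_def)
      show "le s y" if "y \<in> S" for y using s that S(1) unfolding is_sup_in_def by blast
      show "le v s" if "v \<in> X" "\<forall>x\<in>S. le v x" for v using s that unfolding is_sup_in_def by blast
    qed
    then show ?thesis by blast
  qed
  have restrict: "order_closed Y le (C \<inter> Y)" if C: "order_closed X le C" for C
    unfolding order_closed_def
  proof (intro conjI notI)
    assume "\<exists>(I :: ('a \<times> 'a) set) leI. directed_index I leI \<and>
      (\<exists>x\<in>I \<rightarrow> C \<inter> Y. \<exists>l\<in>Y - C \<inter> Y. order_convergent Y le I leI x l)"
    then obtain I :: "('a \<times> 'a) set" and leI x l where I: "directed_index I leI" "x \<in> I \<rightarrow> C \<inter> Y"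
      "l \<in> Y - C \<inter> Y" "order_convergent Y le I leI x l" by blast
    then obtain y z where yz: "y \<in> I \<rightarrow> Y" "z \<in> I \<rightarrow> Y" "\<forall>i\<in>I. le (y i) (x i) \<and> le (x i) (z i)"
      "monotone_on I leI le y" "is_sup_in Y le (y ` I) l"
      "monotone_on I leI (\<lambda>a b. le b a) z" "is_inf_in Y le (z ` I) l"
      unfolding order_convergent_def by blast
    have ne: "y ` I \<noteq> {}" "z ` I \<noteq> {}" using I(1) by (auto simp: directed_index_def)
    have sub: "y ` I \<subseteq> Y" "z ` I \<subseteq> Y" using yz by auto
    have "is_sup_in X le (y ` I) l"
      by (rule is_sup_in_superset[OF antisym complete Y sup_Y yz(5)]) (use ne sub Y in auto)
    moreover have "is_inf_in X le (z ` I) l"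
      unfolding is_inf_in_def
    proof (rule is_sup_in_superset[where Y = Y])
      show "\<exists>s. is_sup_in X (\<lambda>a b. le b a) (z ` I) s" if "u \<in> X" "\<And>x. x \<in> z ` I \<Longrightarrow> le u x" for u
        using inf_exists[of "z ` I" u] that ne sub Y by (auto simp: is_inf_in_def)
      show "s \<in> Y" if "is_sup_in X (\<lambda>a b. le b a) (z ` I) s" for s
        using inf_Y[OF sub(2) ne(2)] that by (simp add: is_inf_in_def)
      show "is_sup_in Y (\<lambda>a b. le b a) (z ` I) l" using yz(7) by (simp add: is_inf_in_def)
    qed (use antisym Y in auto)
    ultimately have "order_convergent X le I leI x l"
      unfolding order_convergent_def using yz Y by (intro bexI[of _ y] bexI[of _ z]) auto
    moreover have "x \<in> I \<rightarrow> C" "l \<in> X - C" using I Y by auto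
    ultimately show False using C I(1) unfolding order_closed_def by blast
  qed simp
  have extend: "order_closed X le C" if C: "order_closed Y le C" for C
    unfolding order_closed_def
  proof (intro conjI notI)
    show "C \<subseteq> X" using C Y by (auto simp: order_closed_def)
  next
    have CY: "C \<subseteq> Y" using C by (simp add: order_closed_def)
    assume "\<exists>(I :: ('a \<times> 'a) set) leI. directed_index I leI \<and>
      (\<exists>x\<in>I \<rightarrow> C. \<exists>l\<in>X - C. order_convergent X le I leI x l)"
    then obtain I :: "('a \<times> 'a) set" and leI x l where I: "directed_index I leI" "x \<in> I \<rightarrow> C"
      "l \<in> X" "l \<notin> C" "order_convergent X le I leI x l" by blast
    then obtain y z where y: "y \<in> I \<rightarrow> X" "monotone_on I leI le y" "is_sup_in X le (y ` I) l"
      and z: "z \<in> I \<rightarrow> X" "monotone_on I leI (\<lambda>a b. le b a) z" "is_inf_in X le (z ` I) l"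
      and yxz: "\<And>i. i \<in> I \<Longrightarrow> le (y i) (x i)" "\<And>i. i \<in> I \<Longrightarrow> le (x i) (z i)"
      unfolding order_convergent_def by blast
    have yX: "y i \<in> X" and zX: "z i \<in> X" and xC: "x i \<in> C" and xY: "x i \<in> Y" and xX: "x i \<in> X" if "i \<in> I" for i
      using that y(1) z(1) I(2) CY Y by auto
    have lz: "le l (z i)" if "i \<in> I" for i
      using that z(3) by (auto simp: is_sup_in_def is_inf_in_def)
    \<comment> \<open>The bounds need not lie in \<open>Y\<close>; they are replaced by the nearest elements of \<open>Y\<close> on the inner side.\<close>
    define U where "U i = {w \<in> Y. le (y i) w}" for i
    define D where "D i = {w \<in> Y. le w (z i)}" for i
    have xU: "x i \<in> U i" and xD: "x i \<in> D i" if "i \<in> I" for i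
      using xY yxz that by (simp_all add: U_def D_def)
    have UX: "U i \<subseteq> X" and DX: "D i \<subseteq> X" for i using Y by (auto simp: U_def D_def)
    have "\<exists>a. is_inf_in X le (U i) a" if "i \<in> I" for i
      by (rule inf_exists[OF UX _ yX[OF that]]) (use xU[OF that] in \<open>auto simp: U_def\<close>)
    then obtain y' where y': "\<And>i. i \<in> I \<Longrightarrow> is_inf_in X le (U i) (y' i)" by metis
    have "\<exists>a. is_sup_in X le (D i) a" if "i \<in> I" for i
      by (rule complete[OF DX _ zX[OF that]]) (use xD[OF that] in \<open>auto simp: D_def\<close>)
    then obtain z' where z': "\<And>i. i \<in> I \<Longrightarrow> is_sup_in X le (D i) (z' i)" by metis
    have y'Y: "y' i \<in> Y" and z'Y: "z' i \<in> Y" if i: "i \<in> I" for i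
    proof -
      have "U i \<noteq> {}" "D i \<noteq> {}" using xU[OF i] xD[OF i] by blast+
      then show "y' i \<in> Y" "z' i \<in> Y"
        using inf_Y[OF _ _ y'[OF i]] sup_Y[OF _ _ z'[OF i]] by (simp_all add: U_def D_def)
    qed
    then have y'X: "y' i \<in> X" and z'X: "z' i \<in> X" if "i \<in> I" for i using that Y by blast+
    have y'_le: "le (y' i) w" if "i \<in> I" "w \<in> Y" "le (y i) w" for i w
      using y'[OF that(1)] that by (auto simp: U_def is_inf_in_def is_sup_in_def)
    have le_z': "le w (z' i)" if "i \<in> I" "w \<in> Y" "le w (z i)" for i w
      using z'[OF that(1)] that by (auto simp: D_def is_sup_in_def)
    have yy': "le (y i) (y' i)" if "i \<in> I" for i
      using y'[OF that] yX[OF that] by (auto simp: U_def is_inf_in_def is_sup_in_def)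
    have z'z: "le (z' i) (z i)" if "i \<in> I" for i
      using z'[OF that] zX[OF that] by (auto simp: D_def is_sup_in_def)
    have y_mono: "le (y i) (y j)" and z_mono: "le (z j) (z i)" if "i \<in> I" "j \<in> I" "leI i j" for i j
      using that y(2) z(2) by (auto simp: monotone_on_def)
    \<comment> \<open>Every \<open>y' i\<close> is below every \<open>z j\<close>: at a common later index, both can be compared with the net.\<close>
    have y'l: "le (y' i) l" if i: "i \<in> I" for i
    proof -
      have "le (y' i) (z j)" if j: "j \<in> I" for j
      proof -
        obtain k where k: "k \<in> I" "leI i k" "leI j k"
          using I(1) i j unfolding directed_index_def by blast
        have "le (y i) (x k)" using trans'[OF y_mono[OF i k(1,2)] yxz(1)[OF k(1)]] yX xX i k by blast
        then have "le (y' i) (x k)" using y'_le[OF i xY[OF k(1)]] by blast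
        then have "le (y' i) (z k)" using trans' yxz(2) y'X xX zX i k(1) by blast
        then show ?thesis using trans' z_mono[OF j k(1,3)] y'X zX i j k(1) by blast
      qed
      then show ?thesis using z(3) y'X[OF i] by (auto simp: is_inf_in_def is_sup_in_def)
    qed
    have sup_y': "is_sup_in X le (y' ` I) l"
      unfolding is_sup_in_def
    proof (intro conjI ballI impI)
      fix u assume u: "u \<in> X" "\<forall>a\<in>y' ` I. le a u"
      then have "le (y i) u" if "i \<in> I" for i using that trans'[OF yy'] yX y'X by blast
      then show "le l u" using y(3) u(1) by (auto simp: is_sup_in_def)
    qed (use I(3) y'l in auto)
    have "y' ` I \<subseteq> Y" "y' ` I \<noteq> {}" using y'Y I(1) by (auto simp: directed_index_def)
    then have lY: "l \<in> Y" using sup_Y sup_y' by blast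
    have "order_convergent Y le I leI x l"
      unfolding order_convergent_def
    proof (rule bexI[of _ y'], rule bexI[of _ z'], intro conjI ballI)
      show "y' \<in> I \<rightarrow> Y" "z' \<in> I \<rightarrow> Y" using y'Y z'Y by auto
      show "le (y' i) (x i)" "le (x i) (z' i)" if "i \<in> I" for i
        using that y'_le le_z' xY yxz by auto
      show "monotone_on I leI le y'"
      proof (rule monotone_onI)
        fix i j assume ij: "i \<in> I" "j \<in> I" "leI i j"
        have "le (y i) (y' j)" using trans'[OF y_mono[OF ij] yy'[OF ij(2)]] yX y'X ij by blast
        then show "le (y' i) (y' j)" using y'_le[OF ij(1) y'Y[OF ij(2)]] by blast
      qed
      show "monotone_on I leI (\<lambda>a b. le b a) z'"
      proof (rule monotone_onI)
        fix i j assume ij: "i \<in> I" "j \<in> I" "leI i j"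
        have "le (z' j) (z i)" using trans'[OF z'z[OF ij(2)] z_mono[OF ij]] zX z'X ij by blast
        then show "le (z' j) (z' i)" using le_z'[OF ij(1) z'Y[OF ij(2)]] by blast
      qed
      show "is_sup_in Y le (y' ` I) l"
        using sup_y' lY Y unfolding is_sup_in_def by blast
      show "is_inf_in Y le (z' ` I) l"
        unfolding is_inf_in_def is_sup_in_def
      proof (intro conjI ballI impI)
        show "le l a" if "a \<in> z' ` I" for a using that le_z' lz lY by auto
        fix u assume u: "u \<in> Y" "\<forall>a\<in>z' ` I. le u a"
        then have "le u (z i)" if "i \<in> I" for i using that trans'[OF _ z'z] zX z'X Y by blast
        moreover have "u \<in> X" using u(1) Y by blast
        ultimately show "le u l" using z(3) by (simp add: is_inf_in_def is_sup_in_def)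
      qed (rule lY)
    qed
    then show False using C I(1,2,4) lY unfolding order_closed_def by blast
  qed
  show ?thesis
    unfolding topology_eq
  proof
    fix U
    note closed_X = closedin_poset_order_topology[OF trans] and closed_Y = closedin_poset_order_topology[OF trans_Y]
    have closed: "closedin (subtopology (poset_order_topology X le) Y) C \<longleftrightarrow>
        closedin (poset_order_topology Y le) C" for C
    proof -
      have "C \<subseteq> Y" if "order_closed Y le C" using that by (simp add: order_closed_def)
      then show ?thesis
        unfolding closedin_subtopology closed_X closed_Y using restrict extend by (metis inf.absorb1)
    qed
    have "topspace (subtopology (poset_order_topology X le) Y) = topspace (poset_order_topology Y le)"
      using Y by (simp add: closed_X closed_Y inf.absorb2)
    then show "openin (subtopology (poset_order_topology X le) Y) U \<longleftrightarrow> openin (poset_order_topology Y le) U"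
      using closed by (simp add: openin_closedin_eq)
  qed
qed

section \<open>Order topologies of the star order\<close>

lemma subtopology_star_order_topology:
  assumes M: "von_neumann_algebra M" and Y: "Y \<subseteq> M"
    and sup_Y: "\<And>S s. S \<subseteq> Y \<Longrightarrow> S \<noteq> {} \<Longrightarrow> is_sup_in M (\<preceq>\<^sub>\<star>) S s \<Longrightarrow> s \<in> Y"
    and inf_Y: "\<And>S s. S \<subseteq> Y \<Longrightarrow> S \<noteq> {} \<Longrightarrow> is_inf_in M (\<preceq>\<^sub>\<star>) S s \<Longrightarrow> s \<in> Y"
  shows "subtopology (poset_order_topology M (\<preceq>\<^sub>\<star>)) Y = poset_order_topology Y (\<preceq>\<^sub>\<star>)"
proof (rule subtopology_poset_order_topology[OF _ _ _ Y sup_Y inf_Y])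
  have C: "x \<in> cbounded_ops" if "x \<in> M" for x using that von_neumann_algebraD(1)[OF M] by blast
  show "x = y" if "x \<in> M" "y \<in> M" "x \<preceq>\<^sub>\<star> y" "y \<preceq>\<^sub>\<star> x" for x y
    using star_le_antisym that C by blast
  show "transp_on M (\<preceq>\<^sub>\<star>)" unfolding transp_on_def using star_le_trans C by blast
  show "\<exists>s. is_sup_in M (\<preceq>\<^sub>\<star>) S s" if "S \<subseteq> M" "S \<noteq> {}" "u \<in> M" "\<And>x. x \<in> S \<Longrightarrow> x \<preceq>\<^sub>\<star> u" for S u
    using star_sup_compression[OF M that(1,3,4)] by metis
qed

theorem corollary4p12:
  fixes M :: "('h::chilbert_space \<Rightarrow>\<^sub>L 'h) set"
  assumes "von_neumann_algebra M"
  shows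
    "(subtopology (poset_order_topology M (\<preceq>\<^sub>\<star>)) (partial_isometries M)
        = poset_order_topology (partial_isometries M) (\<preceq>\<^sub>\<star>)) \<and>
     (subtopology (poset_order_topology M (\<preceq>\<^sub>\<star>)) (self_adjoints M)
        = poset_order_topology (self_adjoints M) (\<preceq>\<^sub>\<star>)) \<and>
     (subtopology (poset_order_topology M (\<preceq>\<^sub>\<star>)) (positives M)
        = subtopology (poset_order_topology (self_adjoints M) (\<preceq>\<^sub>\<star>)) (positives M) \<and>
      subtopology (poset_order_topology (self_adjoints M) (\<preceq>\<^sub>\<star>)) (positives M)
        = poset_order_topology (positives M) (\<preceq>\<^sub>\<star>)) \<and>
     (subtopology (poset_order_topology M (\<preceq>\<^sub>\<star>)) (projections M)
        = subtopology (poset_order_topology (self_adjoints M) (\<preceq>\<^sub>\<star>)) (projections M) \<and>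
      subtopology (poset_order_topology (self_adjoints M) (\<preceq>\<^sub>\<star>)) (projections M)
        = subtopology (poset_order_topology (positives M) (\<preceq>\<^sub>\<star>)) (projections M) \<and>
      subtopology (poset_order_topology (positives M) (\<preceq>\<^sub>\<star>)) (projections M)
        = poset_order_topology (projections M) (\<preceq>\<^sub>\<star>))"
proof -
  note M = assms
  let ?T = "poset_order_topology M (\<preceq>\<^sub>\<star>)"
  have "self_adjoints M \<subseteq> M" "partial_isometries M \<subseteq> M"
    by (auto simp: self_adjoints_def partial_isometries_def)
  note pos_sa = positives_subset_self_adjoints[OF M]
  have "0 \<le> inner (p h) h" if p: "p \<in> projections M" for p h
  proof -
    have "p \<in> cbounded_ops" "adj p = p" "p (p h) = p h"
      using p von_neumann_algebraD(1)[OF M] by (auto simp: projections_iff self_adjoints_def)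
    then have "inner (p h) h = inner (p h) (p h)" using inner_self_adjoint[of p "p h" h] by simp
    then show ?thesis by simp
  qed
  then have proj_pos: "projections M \<subseteq> positives M"
    by (simp add: subset_iff positives_iff[OF M] projections_iff)
  note sub = \<open>self_adjoints M \<subseteq> M\<close> \<open>partial_isometries M \<subseteq> M\<close> pos_sa proj_pos
  have pi: "subtopology ?T (partial_isometries M) = poset_order_topology (partial_isometries M) (\<preceq>\<^sub>\<star>)"
    using sub by (intro subtopology_star_order_topology[OF M] partial_isometries_sup_closed[OF M]
        partial_isometries_inf_closed[OF M])
  have sa: "subtopology ?T (self_adjoints M) = poset_order_topology (self_adjoints M) (\<preceq>\<^sub>\<star>)"
    using sub by (intro subtopology_star_order_topology[OF M] self_adjoints_sup_closed[OF M]
        self_adjoints_inf_closed[OF M])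
  have pos: "subtopology ?T (positives M) = poset_order_topology (positives M) (\<preceq>\<^sub>\<star>)"
    using sub by (intro subtopology_star_order_topology[OF M] positives_sup_closed[OF M]
        positives_inf_closed[OF M]) auto
  have proj: "subtopology ?T (projections M) = poset_order_topology (projections M) (\<preceq>\<^sub>\<star>)"
    using sub by (intro subtopology_star_order_topology[OF M] projections_sup_closed[OF M]
        projections_inf_closed[OF M]) auto
  have "self_adjoints M \<inter> positives M = positives M" "self_adjoints M \<inter> projections M = projections M"
    "positives M \<inter> projections M = projections M" using sub by blast+
  then show ?thesis
    by (simp add: pi proj sa[symmetric] pos[symmetric] subtopology_subtopology)
qed

end
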